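(* Let $s\in\{1,\dots,p\}$. Assume that the condition $SRE(s,7)$ holds for $\mathbb X$. Let $\hat{\boldsymbol\beta}$ be the Lasso estimator with a tuning parameter $\lambda$ satisfying $$\lambda\ge2(4+\sqrt2)\,\sigma\sqrt{\frac{\log(2ep/s)}n}.$$ Then, with probability at least $1-\frac12\left(\frac s{2ep}\right)^{s/\theta^2(s,7)}$, $$\frac\lambda2|\hat{\boldsymbol\beta}-\boldsymbol\beta|_1+\|\mathbb X\hat{\boldsymbol\beta}-\mathbf f\|_n^2\le\|\mathbb X\boldsymbol\beta-\mathbf f\|_n^2+\frac{49\lambda^2s}{16\,\theta^2(s,7)}$$ for all $\boldsymbol\beta\in\mathbb R^p$ such that $|\boldsymbol\beta|_0\le s$, and all $\mathbf f\in\mathbb R^n$. Furthermore, if $\mathbf f=\mathbb X\boldsymbol\beta^*$ for some $\boldsymbol\beta^*\in\mathbb R^p$ with $|\boldsymbol\beta^*|_0\le s$ then, for any $1\le q\le2$, $$\mathbb P\left(|\hat{\boldsymbol\beta}-\boldsymbol\beta^*|_q\le\frac{49\lambda s^{1/q}}{8\,\theta^2(s,7)}\right)\ge1-\frac12\left(\frac s{2ep}\right)^{s/\theta^2(s,7)}.$$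
   Context: Let $n,p\ge1$ be integers, $\sigma>0$, $\mathbb X\in\mathbb R^{n\times p}$ a deterministic matrix, $\mathbf f\in\mathbb R^n$ deterministic, $\boldsymbol\xi\sim\mathcal N(\mathbf 0,\sigma^2I_{n\times n})$, and $\mathbf y=\mathbf f+\boldsymbol\xi$. For $\boldsymbol u\in\mathbb R^n$, $\|\boldsymbol u\|_n^2=\frac1n\sum_{i=1}^nu_i^2$. $|\cdot|_q$ is the $\ell_q$ norm on $\mathbb R^p$, $|\boldsymbol\beta|_0$ is the number of nonzero components of $\boldsymbol\beta$, and $\boldsymbol e_1,\dots,\boldsymbol e_p$ is the canonical basis of $\mathbb R^p$. Lasso estimator with tuning parameter $\lambda>0$: any $\hat{\boldsymbol\beta}\in\arg\min_{\boldsymbol\beta\in\mathbb R^p}\big(\|\mathbb X\boldsymbol\beta-\mathbf y\|_n^2+2\lambda|\boldsymbol\beta|_1\big)$. Condition $SRE(s,c_0)$ ($c_0>0$): $\|\mathbb X\boldsymbol e_j\|_n\le1$ for all $j=1,\dots,p$, and $$\theta(s,c_0)=\min_{\boldsymbol\delta\in\mathcal C_{SRE}(s,c_0),\,\boldsymbol\delta\ne\mathbf 0}\frac{\|\mathbb X\boldsymbol\delta\|_n}{|\boldsymbol\delta|_2}>0,\qquad\mathcal C_{SRE}(s,c_0)=\{\boldsymbol\delta\in\mathbb R^p:|\boldsymbol\delta|_1\le(1+c_0)\sqrt s\,|\boldsymbol\delta|_2\}.$$ *)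

theory Defs
  imports "HOL-Probability.Probability"
begin

text \<open>Vectors of dimension n and p are \<open>real ^ 'n\<close> and \<open>real ^ 'p\<close>, and the design
  matrix is \<open>X :: real ^ 'p ^ 'n\<close> (n rows, p columns).\<close>

definition emp_norm :: "real ^ 'n \<Rightarrow> real" where
  "emp_norm u = sqrt ((\<Sum>i\<in>UNIV. (u $ i)\<^sup>2) / real CARD('n))"

definition lq_norm :: "real \<Rightarrow> real ^ 'p \<Rightarrow> real" where
  "lq_norm q b = (\<Sum>j\<in>UNIV. \<bar>b $ j\<bar> powr q) powr (1 / q)"

definition l0_norm :: "real ^ 'p \<Rightarrow> nat" where
  "l0_norm b = card {j. b $ j \<noteq> 0}"

lemma lq_norm_1: "lq_norm 1 b = (\<Sum>j\<in>UNIV. \<bar>b $ j\<bar>)"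
  by (simp add: lq_norm_def sum_nonneg)

lemma lq_norm_2: "lq_norm 2 b = norm b"
  by (simp add: lq_norm_def norm_vec_def L2_set_def powr_half_sqrt sum_nonneg)

definition is_lasso :: "real ^ 'p ^ 'n \<Rightarrow> real \<Rightarrow> real ^ 'n \<Rightarrow> real ^ 'p \<Rightarrow> bool" where
  "is_lasso X lam y b \<longleftrightarrow>
     is_arg_min (\<lambda>b. (emp_norm (X *v b - y))\<^sup>2 + 2 * lam * lq_norm 1 b) (\<lambda>_. True) b"

definition cone_SRE :: "nat \<Rightarrow> real \<Rightarrow> (real ^ 'p) set" where
  "cone_SRE s c0 = {d. lq_norm 1 d \<le> (1 + c0) * sqrt (real s) * lq_norm 2 d}"

text \<open>For \<open>s \<ge> 1\<close> and \<open>c0 > 0\<close> the infimum is a minimum: the cone contains the canonical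
  basis vectors, and the ratio is invariant under scaling, so it suffices to range over the
  compact intersection of the cone with the unit sphere.\<close>

definition theta :: "real ^ 'p ^ 'n \<Rightarrow> nat \<Rightarrow> real \<Rightarrow> real" where
  "theta X s c0 = (INF d\<in>cone_SRE s c0 - {0}. emp_norm (X *v d) / lq_norm 2 d)"

definition SRE :: "real ^ 'p ^ 'n \<Rightarrow> nat \<Rightarrow> real \<Rightarrow> bool" where
  "SRE X s c0 \<longleftrightarrow> (\<forall>j. emp_norm (X *v axis j 1) \<le> 1) \<and> theta X s c0 > 0"

text \<open>The law \<open>N(0, \<sigma>\<^sup>2 I)\<close>: independent coordinates, each \<open>N(0, \<sigma>\<^sup>2)\<close>
  (the second parameter of \<^const>\<open>normal_density\<close> is the standard deviation).\<close>

definition gaussian_noise :: "'a measure \<Rightarrow> real \<Rightarrow> ('a \<Rightarrow> real ^ 'n) \<Rightarrow> bool" where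
  "gaussian_noise M \<sigma> xi \<longleftrightarrow>
     (\<forall>i. distributed M lborel (\<lambda>\<omega>. xi \<omega> $ i) (\<lambda>x. ennreal (normal_density 0 \<sigma> x))) \<and>
     prob_space.indep_vars M (\<lambda>_. borel) (\<lambda>i \<omega>. xi \<omega> $ i) UNIV"

end

theory Submission
  imports Defs
begin

text \<open>
Write \<open>u = bhat - b\<close> for the error, \<open>S\<close> for the support of \<open>b\<close>, \<open>L = ln (2 * e * p / s)\<close>, \<open>\<theta>\<close> for the restricted
eigenvalue constant and \<open>t = sqrt (s * L) / \<theta>\<close>. The failure probability allowed by the
theorem is \<open>exp (- t\<^sup>2) / 2\<close>.

First-order optimality of the Lasso (\<open>lasso_basic_inequality\<close>) reduces the prediction bound to an upper
bound for the noise term \<open>\<xi> \<bullet> (X *v u) / n\<close>, uniformly in \<open>u\<close>. It suffices that this term is at most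
\<open>\<kappa> * (12 / 5 * (sqrt s * norm u + \<Sum>j\<in>-S. \<bar>u $ j\<bar>) + 3 * sqrt s / \<theta> * emp_norm (X *v u))\<close> with
\<open>\<kappa> = \<sigma> * sqrt (L / n)\<close>, because \<open>12 / 5 + 3\<close> is below the constant \<open>4 + sqrt 2\<close> of the tuning parameter. Either
\<open>u\<close> lies in the cone, and \<open>\<theta>\<close> converts its Euclidean norm into the prediction norm, or the part of \<open>u\<close>
off the support dominates and the penalty absorbs the noise (\<open>oracle_inequality_deterministic\<close>).

For the noise, consider the set \<open>A\<close> of vectors \<open>y\<close> whose normalized correlations \<open>w\<close> with the columns of \<open>X\<close>
satisfy \<open>(\<Sum>j. exp (3 / 8 * (w $ j)\<^sup>2)) \<le> 4 * p\<close>. On \<open>A\<close> the first part of the bound holds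
(\<open>exp_moment_inner_bound\<close>), and \<open>A\<close> has probability at least \<open>1 / 2\<close>. If \<open>\<xi> / \<sigma>\<close> is only within distance
\<open>3 * t\<close> of \<open>A\<close>, the displacement costs at most the term with the prediction norm (\<open>noise_bound\<close>). It
remains to see that a standard Gaussian vector is rarely far from \<open>A\<close>: two sets at distance \<open>r\<close> satisfy
\<open>P(A) * P(B) \<le> exp (- r\<^sup>2 / 4)\<close> (\<open>gaussian_separated_sets\<close>). This follows from a one-dimensional
inequality of Prekopa-Leindler type that passes to product measures. The factor \<open>9 / 4\<close> in the exponent
\<open>(3 * t)\<^sup>2 / 4 = 9 / 4 * t\<^sup>2\<close> leaves enough room to compensate the constants, since \<open>t\<^sup>2 \<ge> L\<close> and \<open>exp L \<ge> 2 * e\<close>.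

The estimation bounds follow from the prediction bound with \<open>f = X *v bstar\<close> by interpolation between
\<open>q = 1\<close> and \<open>q = 2\<close>. The two events of the theorem are Borel preimages because their complements are
projections of \<open>\<sigma>\<close>-compact sets (\<open>borel_projection_closed_Int_open\<close>).\<close>

section \<open>The Gaussian measure of two distant sets\<close>

lemma nn_integral_layer_cake:
  fixes f :: "real \<Rightarrow> real"
  assumes [measurable]: "f \<in> borel_measurable borel"
  shows "(\<integral>\<^sup>+x. ennreal (f x) \<partial>lborel)
       = (\<integral>\<^sup>+t. emeasure lborel {x. t < f x} * indicator {0<..} t \<partial>lborel)"
proof -
  have "(\<integral>\<^sup>+x. ennreal (f x) \<partial>lborel)
      = (\<integral>\<^sup>+x. (\<integral>\<^sup>+t. indicator {0<..<f x} t \<partial>lborel) \<partial>lborel)"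
  proof (rule nn_integral_cong)
    show "ennreal (f x) = (\<integral>\<^sup>+t. indicator {0<..<f x} t \<partial>lborel)" for x
      by (cases "0 \<le> f x") (auto simp: ennreal_neg)
  qed
  also have "\<dots> = (\<integral>\<^sup>+x. (\<integral>\<^sup>+t. indicator {x. t < f x} x * indicator {0<..} t \<partial>lborel) \<partial>lborel)"
    by (intro nn_integral_cong) (auto simp: indicator_def)
  also have "\<dots> = (\<integral>\<^sup>+t. (\<integral>\<^sup>+x. indicator {x. t < f x} x * indicator {0<..} t \<partial>lborel) \<partial>lborel)"
    by (rule lborel_pair.Fubini'[symmetric]) (measurable)
  also have "\<dots> = (\<integral>\<^sup>+t. emeasure lborel {x. t < f x} * indicator {0<..} t \<partial>lborel)"
    by (intro nn_integral_cong) (simp add: nn_integral_multc)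
  finally show ?thesis .
qed

text \<open>The midpoint set of two bounded sets spans at least the interval between the midpoint of the
infima and the midpoint of the suprema, so an interval that contains it has at least the average
of their measures. This is the one-dimensional Brunn-Minkowski inequality for an interval as target.\<close>

lemma emeasure_midpoint_interval:
  fixes A B H :: "real set"
  assumes A: "A \<noteq> {}" "A \<in> sets borel" and B: "B \<noteq> {}" "B \<in> sets borel"
    and H: "is_interval H" "bounded H" "H \<in> sets borel"
    and mid: "\<And>x y. x \<in> A \<Longrightarrow> y \<in> B \<Longrightarrow> (x + y) / 2 \<in> H"
  shows "emeasure lborel A + emeasure lborel B \<le> 2 * emeasure lborel H"
proof -
  obtain x0 y0 where x0: "x0 \<in> A" and y0: "y0 \<in> B" using A B by auto
  obtain c where c: "\<And>z. z \<in> H \<Longrightarrow> \<bar>z\<bar> \<le> c"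
    using H(2) by (auto simp: bounded_iff)
  have bA: "\<bar>x\<bar> \<le> 2 * c + \<bar>y0\<bar>" if "x \<in> A" for x using c[OF mid[OF that y0]] by auto
  have bB: "\<bar>y\<bar> \<le> 2 * c + \<bar>x0\<bar>" if "y \<in> B" for y using c[OF mid[OF x0 that]] by auto
  have bd: "bdd_above A" "bdd_below A" "bdd_above B" "bdd_below B"
    using bA bB by (meson abs_le_iff bdd_aboveI bdd_belowI minus_le_iff)+
  have subA: "A \<subseteq> {Inf A..Sup A}" and subB: "B \<subseteq> {Inf B..Sup B}"
    using bd by (auto intro: cInf_lower cSup_upper)
  have subH: "{(Inf A + Inf B) / 2 <..< (Sup A + Sup B) / 2} \<subseteq> H"
  proof
    fix z assume z: "z \<in> {(Inf A + Inf B) / 2 <..< (Sup A + Sup B) / 2}"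
    have "2 * z - Sup B < Sup A" "Inf A < 2 * z - Inf B" using z by auto
    then obtain x1 x2 where x1: "x1 \<in> A" "2 * z - Sup B < x1" and x2: "x2 \<in> A" "x2 < 2 * z - Inf B"
      using A(1) bd by (meson less_cSup_iff cInf_less_iff)
    have "2 * z - x1 < Sup B" "Inf B < 2 * z - x2" using x1 x2 by auto
    then obtain y1 y2 where y1: "y1 \<in> B" "2 * z - x1 < y1" and y2: "y2 \<in> B" "y2 < 2 * z - x2"
      using B(1) bd by (meson less_cSup_iff cInf_less_iff)
    have "(x2 + y2) / 2 \<le> z" "z \<le> (x1 + y1) / 2" using y1 y2 by auto
    then show "z \<in> H" using mid[OF x1(1) y1(1)] mid[OF x2(1) y2(1)] H(1) is_interval_1 by blast
  qed
  have le: "Inf A \<le> Sup A" "Inf B \<le> Sup B" using subA subB x0 y0 by force+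
  have "emeasure lborel A + emeasure lborel B \<le> ennreal (Sup A - Inf A) + ennreal (Sup B - Inf B)"
    using le emeasure_mono[OF subA, of lborel] emeasure_mono[OF subB, of lborel] by (intro add_mono) auto
  also have "\<dots> = ennreal 2 * ennreal ((Sup A + Sup B) / 2 - (Inf A + Inf B) / 2)"
    using le by (simp add: ennreal_mult'[symmetric] ennreal_plus[symmetric] field_simps del: ennreal_numeral ennreal_plus)
  also have "\<dots> = 2 * emeasure lborel {(Inf A + Inf B) / 2 <..< (Sup A + Sup B) / 2}"
    using le by simp
  also have "\<dots> \<le> 2 * emeasure lborel H"
    using subH H(3) by (intro mult_left_mono emeasure_mono) auto
  finally show ?thesis .
qed

text \<open>A Prekopa-Leindler inequality, in the stronger form with the arithmetic mean on the left. That
form needs functions of equal supremum: only then are the superlevel sets of both functions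
nonempty for the same thresholds, which is what allows the preceding lemma to be applied to every
threshold and the result to be integrated.\<close>

lemma nn_integral_midpoint_unimodal:
  fixes f g h :: "real \<Rightarrow> real"
  assumes [measurable]: "f \<in> borel_measurable borel" "g \<in> borel_measurable borel"
      "h \<in> borel_measurable borel"
    and f: "\<And>x. f x \<le> 1" "\<And>t. t < 1 \<Longrightarrow> \<exists>x. t < f x"
    and g: "\<And>x. g x \<le> 1" "\<And>t. t < 1 \<Longrightarrow> \<exists>x. t < g x"
    and h: "\<And>x. 0 \<le> h x" "\<And>t. t > 0 \<Longrightarrow> is_interval {x. t < h x}" "\<And>t. t > 0 \<Longrightarrow> bounded {x. t < h x}"
    and mid: "\<And>x y. 0 < f x \<Longrightarrow> 0 < g y \<Longrightarrow> f x * g y \<le> (h ((x + y) / 2))\<^sup>2"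
  shows "(\<integral>\<^sup>+x. f x \<partial>lborel) + (\<integral>\<^sup>+x. g x \<partial>lborel) \<le> 2 * (\<integral>\<^sup>+x. h x \<partial>lborel)"
proof -
  have "emeasure lborel {x. t < f x} * indicator {0<..} t + emeasure lborel {x. t < g x} * indicator {0<..} t
     \<le> 2 * (emeasure lborel {x. t < h x} * indicator {0<..} t)" for t
  proof (cases "0 < t \<and> t < 1")
    case True
    have "emeasure lborel {x. t < f x} + emeasure lborel {x. t < g x} \<le> 2 * emeasure lborel {x. t < h x}"
    proof (rule emeasure_midpoint_interval)
      fix x y assume "x \<in> {x. t < f x}" "y \<in> {x. t < g x}"
      then have *: "t < f x" "t < g y" by auto
      have "t\<^sup>2 < f x * g y" unfolding power2_eq_square
        using * True by (intro mult_strict_mono) auto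
      also have "\<dots> \<le> (h ((x + y) / 2))\<^sup>2" using * True by (intro mid) auto
      finally show "(x + y) / 2 \<in> {x. t < h x}" using h(1) power_less_imp_less_base by blast
    qed (use True f g h in auto)
    then show ?thesis using True by simp
  next
    case False
    then have "indicator {0<..} t = (0::ennreal) \<or> {x. t < f x} = {} \<and> {x. t < g x} = {}"
      using f(1) g(1) by (auto simp: indicator_def not_less intro: order_trans)
    then show ?thesis by auto
  qed
  then show ?thesis
    by (simp add: nn_integral_layer_cake nn_integral_add[symmetric] nn_integral_cmult[symmetric] nn_integral_mono)
qed

text \<open>The parallelogram identity \<open>x\<^sup>2 / 2 + y\<^sup>2 / 2 - (x - y)\<^sup>2 / 4 = ((x + y) / 2)\<^sup>2\<close>; it is the reason for the
constant \<open>4\<close> in the exponents below.\<close>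

lemma std_normal_density_midpoint:
  "std_normal_density x * std_normal_density y * exp ((x - y)\<^sup>2 / 4) = (std_normal_density ((x + y) / 2))\<^sup>2"
proof -
  have "- x\<^sup>2 / 2 + - y\<^sup>2 / 2 + (x - y)\<^sup>2 / 4 = 2 * (- ((x + y) / 2)\<^sup>2 / 2)"
    by (simp add: power2_eq_square field_simps)
  then have "exp (- x\<^sup>2 / 2) * exp (- y\<^sup>2 / 2) * exp ((x - y)\<^sup>2 / 4) = (exp (- ((x + y) / 2)\<^sup>2 / 2))\<^sup>2"
    by (simp only: exp_add[symmetric] exp_double[symmetric])
  then show ?thesis
    unfolding std_normal_density_def by (simp add: power2_eq_square mult_ac)
qed

lemma std_normal_level_interval: "is_interval {x. t < std_normal_density x}"
proof -
  have "t < std_normal_density z"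
    if "x \<le> z" "z \<le> y" "t < std_normal_density x" "t < std_normal_density y" for x y z
  proof -
    have "z\<^sup>2 \<le> x\<^sup>2 \<or> z\<^sup>2 \<le> y\<^sup>2"
      using that(1,2) by (auto simp: abs_le_square_iff[symmetric])
    then have "std_normal_density x \<le> std_normal_density z \<or> std_normal_density y \<le> std_normal_density z"
      unfolding std_normal_density_def by (auto intro!: divide_right_mono)
    with that show ?thesis by auto
  qed
  then show ?thesis unfolding is_interval_1 by blast
qed

lemma std_normal_level_bounded:
  assumes "t > 0" shows "bounded {x. t < std_normal_density x}"
proof -
  have "\<bar>x\<bar> \<le> 2 / t + 1" if "t < std_normal_density x" for x
  proof -
    have "std_normal_density x \<le> 1 * exp (- x\<^sup>2 / 2)"
      unfolding std_normal_density_def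
      using pi_gt3 by (intro mult_right_mono) (auto simp: real_le_rsqrt)
    also have "\<dots> \<le> 1 / (x\<^sup>2 / 2)" if "x \<noteq> 0"
      using that exp_ge_add_one_self[of "x\<^sup>2 / 2"]
      by (simp add: exp_minus field_simps)
    finally have "t \<le> 1 / (x\<^sup>2 / 2)" if "x \<noteq> 0" using that \<open>t < std_normal_density x\<close> by auto
    then have "x\<^sup>2 \<le> 2 / t" using assms by (cases "x = 0") (auto simp: field_simps)
    moreover have "\<bar>x\<bar> \<le> x\<^sup>2 + 1" using zero_le_power2[of "\<bar>x\<bar> - 1"]
      by (simp add: power2_diff)
    ultimately show ?thesis by linarith
  qed
  then show ?thesis unfolding bounded_iff by auto
qed

abbreviation "\<gamma> \<equiv> density lborel (\<lambda>x. ennreal (std_normal_density x))"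

text \<open>Maurey's property \<open>(\<tau>)\<close> of the Gaussian measure with the cost \<open>(x - y)\<^sup>2 / 4\<close>, stated for two functions
instead of for an infimal convolution. Multiplying both functions by the Gaussian density turns the
hypothesis into \<open>f x * g y \<le> \<phi>((x + y) / 2)\<^sup>2\<close>, where the superlevel sets of \<open>\<phi>\<close> are intervals.
Dividing \<open>f\<close> and \<open>g\<close> by their suprema makes \<open>nn_integral_midpoint_unimodal\<close> applicable, and the
arithmetic-geometric mean inequality undoes the division.\<close>

theorem gaussian_property_tau_1d:
  fixes F G :: "real \<Rightarrow> ennreal"
  assumes [measurable]: "F \<in> borel_measurable borel" "G \<in> borel_measurable borel"
    and FG: "\<And>x y. F x * G y \<le> ennreal (exp ((x - y)\<^sup>2 / 4))"
  shows "(\<integral>\<^sup>+x. F x \<partial>\<gamma>) * (\<integral>\<^sup>+x. G x \<partial>\<gamma>) \<le> 1"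
proof (cases "(\<forall>x. F x = 0) \<or> (\<forall>y. G y = 0)")
  case True then show ?thesis by auto
next
  case False
  then obtain x0 y0 where nz: "F x0 \<noteq> 0" "G y0 \<noteq> 0" by auto
  have F_fin: "F x \<noteq> \<top>" for x using FG[of x y0] nz by (auto simp: top_unique)
  have G_fin: "G y \<noteq> \<top>" for y using FG[of x0 y] nz by (auto simp: top_unique)
  let ?\<phi> = "std_normal_density"
  define f g where "f = (\<lambda>x. enn2real (F x) * ?\<phi> x)" and "g = (\<lambda>x. enn2real (G x) * ?\<phi> x)"
  have [measurable]: "f \<in> borel_measurable borel" "g \<in> borel_measurable borel"
    unfolding f_def g_def by measurable
  have fg: "f x * g y \<le> (?\<phi> ((x + y) / 2))\<^sup>2" for x y
  proof -
    have "enn2real (F x) * enn2real (G y) \<le> exp ((x - y)\<^sup>2 / 4)"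
      using enn2real_mono[OF FG[of x y]] by (simp add: enn2real_mult)
    then have "enn2real (F x) * enn2real (G y) * (?\<phi> x * ?\<phi> y) \<le> exp ((x - y)\<^sup>2 / 4) * (?\<phi> x * ?\<phi> y)"
      by (intro mult_right_mono) auto
    then show ?thesis unfolding f_def g_def std_normal_density_midpoint[symmetric] by (simp add: mult_ac)
  qed
  have \<phi>1: "(?\<phi> x)\<^sup>2 \<le> 1" for x
  proof -
    have "?\<phi> x \<le> 1" unfolding std_normal_density_def
      using pi_gt3 by (intro mult_le_one) (auto simp: real_le_rsqrt)
    then show ?thesis by (simp add: power_le_one)
  qed
  have fx0: "f x0 > 0" and gy0: "g y0 > 0" unfolding f_def g_def using nz F_fin G_fin
    by (auto simp: enn2real_positive_iff less_top zero_less_iff_neq_zero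
        intro!: mult_pos_pos normal_density_pos)
  have bdf: "bdd_above (range f)"
    using order_trans[OF fg \<phi>1] gy0 by (intro bdd_aboveI[of _ "1 / g y0"]) (auto simp: field_simps)
  have bdg: "bdd_above (range g)"
    using order_trans[OF fg \<phi>1] fx0 by (intro bdd_aboveI[of _ "1 / f x0"]) (auto simp: field_simps)
  define a b where "a = (SUP x. f x)" and "b = (SUP x. g x)"
  have fa: "f x \<le> a" and gb: "g x \<le> b" for x unfolding a_def b_def
    using bdf bdg by (auto intro: cSUP_upper)
  have a: "a > 0" and b: "b > 0" using fa[of x0] gb[of y0] fx0 gy0 by linarith+
  let ?c = "sqrt (a * b)"
  have c: "?c > 0" using a b by simp
  have "(\<integral>\<^sup>+x. f x / a \<partial>lborel) + (\<integral>\<^sup>+x. g x / b \<partial>lborel) \<le> 2 * (\<integral>\<^sup>+x. ?\<phi> x / ?c \<partial>lborel)"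
  proof (rule nn_integral_midpoint_unimodal)
    show "\<exists>x. t < f x / a" if "t < 1" for t
    proof -
      have "t * a < a" using that a by simp
      then have "\<exists>x. t * a < f x"
        using less_cSUP_iff[of UNIV f "t * a"] bdf unfolding a_def[symmetric] by auto
      then show ?thesis using a by (simp add: pos_less_divide_eq)
    qed
    show "\<exists>x. t < g x / b" if "t < 1" for t
    proof -
      have "t * b < b" using that b by simp
      then have "\<exists>x. t * b < g x"
        using less_cSUP_iff[of UNIV g "t * b"] bdg unfolding b_def[symmetric] by auto
      then show ?thesis using b by (simp add: pos_less_divide_eq)
    qed
    fix t :: real assume t: "0 < t"
    have "{x. t < ?\<phi> x / ?c} = {x. t * ?c < ?\<phi> x}" using c by (simp add: pos_less_divide_eq)
    then show "is_interval {x. t < ?\<phi> x / ?c}" "bounded {x. t < ?\<phi> x / ?c}"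
      using std_normal_level_interval std_normal_level_bounded t c by (auto simp del: real_sqrt_mult)
  next
    fix x y
    have "f x * g y / (a * b) \<le> (?\<phi> ((x + y) / 2))\<^sup>2 / (a * b)"
      using fg a b by (intro divide_right_mono) auto
    then show "f x / a * (g y / b) \<le> (?\<phi> ((x + y) / 2) / ?c)\<^sup>2"
      using a b by (simp add: power_divide)
  qed (use fa gb a b c in auto)
  also have "(\<integral>\<^sup>+x. ?\<phi> x / ?c \<partial>lborel) = ennreal (1 / ?c)"
  proof -
    have "(\<integral>\<^sup>+x. ?\<phi> x / ?c \<partial>lborel) = ennreal (LINT x|lborel. ?\<phi> x / ?c)"
      using c by (intro nn_integral_eq_integral) (auto intro!: integrable_divide)
    then show ?thesis by (simp add: integral_divide_zero)
  qed
  finally have sum_le: "(\<integral>\<^sup>+x. f x / a \<partial>lborel) + (\<integral>\<^sup>+x. g x / b \<partial>lborel) \<le> ennreal (2 / ?c)"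
    using c by (simp add: ennreal_mult'[symmetric] flip: ennreal_numeral)
  have scale: "(\<integral>\<^sup>+x. K x \<partial>\<gamma>) = ennreal d * (\<integral>\<^sup>+x. enn2real (K x) * ?\<phi> x / d \<partial>lborel)"
    if [measurable]: "K \<in> borel_measurable borel" and "\<And>x. K x \<noteq> \<top>" "d > 0" for K :: "real \<Rightarrow> ennreal" and d
  proof -
    have "(\<integral>\<^sup>+x. K x \<partial>\<gamma>) = (\<integral>\<^sup>+x. ennreal (?\<phi> x) * K x \<partial>lborel)"
      by (rule nn_integral_density) auto
    also have "\<dots> = (\<integral>\<^sup>+x. ennreal d * ennreal (enn2real (K x) * ?\<phi> x / d) \<partial>lborel)"
      using that(2,3)
      by (intro nn_integral_cong) (auto simp: ennreal_mult'[symmetric] ennreal_mult'' less_top mult.commute)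
    also have "\<dots> = ennreal d * (\<integral>\<^sup>+x. enn2real (K x) * ?\<phi> x / d \<partial>lborel)"
      by (rule nn_integral_cmult) measurable
    finally show ?thesis .
  qed
  define P Q where "P = enn2real (\<integral>\<^sup>+x. f x / a \<partial>lborel)" and "Q = enn2real (\<integral>\<^sup>+x. g x / b \<partial>lborel)"
  have fin: "(\<integral>\<^sup>+x. f x / a \<partial>lborel) < \<top>" "(\<integral>\<^sup>+x. g x / b \<partial>lborel) < \<top>"
    using sum_le by (auto simp: less_top[symmetric] top_unique)
  have PQ: "(\<integral>\<^sup>+x. f x / a \<partial>lborel) = ennreal P" "(\<integral>\<^sup>+x. g x / b \<partial>lborel) = ennreal Q" "P \<ge> 0" "Q \<ge> 0"
    unfolding P_def Q_def using fin by auto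
  have "P + Q \<le> 2 / ?c"
    using sum_le PQ c by (simp add: ennreal_plus[symmetric] del: ennreal_plus)
  then have "(P + Q)\<^sup>2 \<le> (2 / ?c)\<^sup>2" using PQ by (intro power_mono) auto
  moreover have "4 * (P * Q) \<le> (P + Q)\<^sup>2"
    using zero_le_power2[of "P - Q"] by (simp add: power2_eq_square algebra_simps)
  moreover have "(2 / ?c)\<^sup>2 = 4 / (a * b)" using a b by (simp add: power_divide)
  ultimately have "P * Q \<le> 1 / (a * b)" by simp
  then have "(a * P) * (b * Q) \<le> 1" using a b by (simp add: field_simps)
  moreover have "(\<integral>\<^sup>+x. F x \<partial>\<gamma>) * (\<integral>\<^sup>+x. G x \<partial>\<gamma>) = ennreal ((a * P) * (b * Q))"
    using scale[of F a] scale[of G b] F_fin G_fin a b PQ unfolding f_def g_def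
    by (simp add: ennreal_mult)
  ultimately show ?thesis by simp
qed

text \<open>The two-function form tensorizes by Fubini: if one coordinate of each argument is fixed, the
induction hypothesis bounds the product of the two inner integrals by the one-dimensional cost of
the fixed coordinates. The hypothesis of the one-dimensional inequality therefore holds for the
inner integrals themselves.\<close>

theorem gaussian_property_tau_PiM:
  fixes F G :: "('i \<Rightarrow> real) \<Rightarrow> ennreal"
  assumes "finite I"
    and "F \<in> borel_measurable (PiM I (\<lambda>_. \<gamma>))" "G \<in> borel_measurable (PiM I (\<lambda>_. \<gamma>))"
    and "\<And>x y. F x * G y \<le> ennreal (exp ((\<Sum>i\<in>I. (x i - y i)\<^sup>2) / 4))"
  shows "(\<integral>\<^sup>+x. F x \<partial>PiM I (\<lambda>_. \<gamma>)) * (\<integral>\<^sup>+x. G x \<partial>PiM I (\<lambda>_. \<gamma>)) \<le> 1"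
  using assms
proof (induction I arbitrary: F G rule: finite_induct)
  case empty
  then show ?case using empty.prems(3)[of "\<lambda>_. undefined" "\<lambda>_. undefined"]
    by (simp add: PiM_empty nn_integral_count_space_finite)
next
  case (insert i I)
  interpret N: prob_space \<gamma> by (rule prob_space_normal_density) simp
  interpret product_sigma_finite "\<lambda>_::'i. \<gamma>" by standard
  interpret P: finite_product_sigma_finite "\<lambda>_::'i. \<gamma>" I by standard (rule insert.hyps)
  note [measurable] = insert.prems(1,2)
  have rev: "(\<integral>\<^sup>+x. K x \<partial>PiM (insert i I) (\<lambda>_. \<gamma>)) = (\<integral>\<^sup>+u. (\<integral>\<^sup>+x. K (x(i := u)) \<partial>PiM I (\<lambda>_. \<gamma>)) \<partial>\<gamma>)"
    if "K \<in> borel_measurable (PiM (insert i I) (\<lambda>_. \<gamma>))" for K :: "('i \<Rightarrow> real) \<Rightarrow> ennreal"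
    using insert.hyps that by (rule product_nn_integral_insert_rev)
  show ?case unfolding rev[OF insert.prems(1)] rev[OF insert.prems(2)]
  proof (rule gaussian_property_tau_1d)
    have "(\<lambda>u. \<integral>\<^sup>+x. F (x(i := u)) \<partial>PiM I (\<lambda>_. \<gamma>)) \<in> borel_measurable \<gamma>" by measurable
    then show "(\<lambda>u. \<integral>\<^sup>+x. F (x(i := u)) \<partial>PiM I (\<lambda>_. \<gamma>)) \<in> borel_measurable borel" by simp
    have "(\<lambda>u. \<integral>\<^sup>+x. G (x(i := u)) \<partial>PiM I (\<lambda>_. \<gamma>)) \<in> borel_measurable \<gamma>" by measurable
    then show "(\<lambda>u. \<integral>\<^sup>+x. G (x(i := u)) \<partial>PiM I (\<lambda>_. \<gamma>)) \<in> borel_measurable borel" by simp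
    fix u v :: real
    let ?c = "exp ((u - v)\<^sup>2 / 4)"
    let ?F = "\<lambda>x. F (x(i := u))" and ?G = "\<lambda>x. G (x(i := v))"
    have u: "u \<in> space \<gamma>" "v \<in> space \<gamma>" by simp_all
    have mF [measurable]: "?F \<in> borel_measurable (PiM I (\<lambda>_. \<gamma>))" using u by measurable
    have mG [measurable]: "?G \<in> borel_measurable (PiM I (\<lambda>_. \<gamma>))" using u by measurable
    have "(\<integral>\<^sup>+x. ennreal (1 / ?c) * ?F x \<partial>PiM I (\<lambda>_. \<gamma>)) * (\<integral>\<^sup>+x. ?G x \<partial>PiM I (\<lambda>_. \<gamma>)) \<le> 1"
    proof (rule insert.IH)
      fix x y :: "'i \<Rightarrow> real"
      have "(\<Sum>j\<in>I. ((x(i := u)) j - (y(i := v)) j)\<^sup>2) = (\<Sum>j\<in>I. (x j - y j)\<^sup>2)"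
        using insert.hyps by (intro sum.cong) auto
      then have "(\<Sum>j\<in>insert i I. ((x(i := u)) j - (y(i := v)) j)\<^sup>2) = (u - v)\<^sup>2 + (\<Sum>j\<in>I. (x j - y j)\<^sup>2)"
        using insert.hyps by simp
      then have "?F x * ?G y \<le> ennreal (exp (((u - v)\<^sup>2 + (\<Sum>j\<in>I. (x j - y j)\<^sup>2)) / 4))"
        using insert.prems(3)[of "x(i := u)" "y(i := v)"] by (simp only:)
      then have "ennreal (1 / ?c) * (?F x * ?G y)
          \<le> ennreal (1 / ?c) * ennreal (exp (((u - v)\<^sup>2 + (\<Sum>j\<in>I. (x j - y j)\<^sup>2)) / 4))"
        by (intro mult_left_mono) auto
      also have "\<dots> = ennreal (exp ((\<Sum>j\<in>I. (x j - y j)\<^sup>2) / 4))"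
        by (simp add: ennreal_mult'[symmetric] add_divide_distrib exp_add)
      finally show "ennreal (1 / ?c) * ?F x * ?G y \<le> ennreal (exp ((\<Sum>j\<in>I. (x j - y j)\<^sup>2) / 4))"
        by (simp add: mult.assoc)
    qed measurable
    then have "ennreal ?c * (ennreal (1 / ?c) * ((\<integral>\<^sup>+x. ?F x \<partial>PiM I (\<lambda>_. \<gamma>)) * (\<integral>\<^sup>+x. ?G x \<partial>PiM I (\<lambda>_. \<gamma>))))
        \<le> ennreal ?c * 1"
      by (intro mult_left_mono) (auto simp: nn_integral_cmult mult.assoc)
    then show "(\<integral>\<^sup>+x. ?F x \<partial>PiM I (\<lambda>_. \<gamma>)) * (\<integral>\<^sup>+x. ?G x \<partial>PiM I (\<lambda>_. \<gamma>)) \<le> ennreal ?c"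
      by (simp add: mult.assoc[symmetric] ennreal_mult'[symmetric])
  qed
qed

lemma gaussian_noise_standardize:
  fixes xi :: "'a \<Rightarrow> real ^ 'n"
  assumes "prob_space M" "\<sigma> > 0" "gaussian_noise M \<sigma> xi"
  shows "gaussian_noise M 1 (\<lambda>\<omega>. xi \<omega> /\<^sub>R \<sigma>)"
proof -
  interpret prob_space M by fact
  have "distributed M lborel (\<lambda>\<omega>. (xi \<omega> $ i - 0) / \<sigma>) std_normal_density" for i
    using assms normal_standard_normal_convert[of \<sigma> "\<lambda>\<omega>. xi \<omega> $ i" 0] unfolding gaussian_noise_def by auto
  moreover have "indep_vars (\<lambda>_. borel) (\<lambda>i \<omega>. inverse \<sigma> * (xi \<omega> $ i)) UNIV"
    using assms unfolding gaussian_noise_def by (intro indep_vars_compose2[where Y="\<lambda>_ x. inverse \<sigma> * x"]) auto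
  ultimately show ?thesis unfolding gaussian_noise_def by (simp add: divide_inverse mult.commute)
qed

lemma gaussian_noise_measurable:
  fixes Z :: "'a \<Rightarrow> real ^ 'n"
  assumes "gaussian_noise M \<sigma> Z"
  shows "Z \<in> borel_measurable M"
proof (subst borel_measurable_euclidean_space, rule ballI)
  fix b :: "real ^ 'n" assume "b \<in> Basis"
  then obtain i where b: "b = axis i 1" by (auto simp: Basis_vec_def)
  have "(\<lambda>\<omega>. Z \<omega> $ i) \<in> measurable M lborel"
    using assms unfolding gaussian_noise_def distributed_def by blast
  then show "(\<lambda>\<omega>. Z \<omega> \<bullet> b) \<in> borel_measurable M" by (simp add: b inner_axis)
qed

text \<open>Property \<open>(\<tau>)\<close> for the indicator functions of \<open>A\<close> and \<open>B\<close>, one of them scaled by \<open>exp (r\<^sup>2 / 4)\<close>. The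
bound does not depend on the dimension.\<close>

theorem gaussian_separated_sets:
  fixes Z :: "'a \<Rightarrow> real ^ 'n" and A B :: "(real ^ 'n) set"
  assumes "prob_space M" and Z: "gaussian_noise M 1 Z"
    and [measurable]: "A \<in> sets borel" "B \<in> sets borel"
    and sep: "\<And>x y. x \<in> A \<Longrightarrow> y \<in> B \<Longrightarrow> r \<le> dist x y" and "r \<ge> 0"
  shows "measure M (Z -` A \<inter> space M) * measure M (Z -` B \<inter> space M) \<le> exp (- r\<^sup>2 / 4)"
proof -
  interpret prob_space M by fact
  have ZM [measurable]: "Z \<in> borel_measurable M" using Z by (rule gaussian_noise_measurable)
  let ?P = "PiM (UNIV :: 'n set) (\<lambda>_. \<gamma>)"
  have "distr M borel (\<lambda>\<omega>. Z \<omega> $ i) = \<gamma>" for i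
    using Z unfolding gaussian_noise_def distributed_def by (metis distr_cong sets_lborel)
  then have law: "distr M (PiM UNIV (\<lambda>_. borel)) (\<lambda>\<omega>. \<lambda>i\<in>UNIV. Z \<omega> $ i) = ?P"
    using Z indep_vars_iff_distr_eq_PiM[where I=UNIV and M'="\<lambda>_. borel" and X="\<lambda>i \<omega>. Z \<omega> $ i"]
    unfolding gaussian_noise_def using ZM by (simp add: measurable_compose[OF ZM borel_measurable_nth])
  have vec [measurable]: "vec_lambda \<in> measurable ?P borel"
  proof (subst borel_measurable_euclidean_space, rule ballI)
    fix b :: "real ^ 'n" assume "b \<in> Basis"
    then obtain i where b: "b = axis i 1" by (auto simp: Basis_vec_def)
    have "(\<lambda>x. x i) \<in> measurable ?P \<gamma>" by measurable
    then show "(\<lambda>x. vec_lambda x \<bullet> b) \<in> borel_measurable ?P" by (simp add: b inner_axis)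
  qed
  have em: "emeasure M (Z -` S \<inter> space M) = (\<integral>\<^sup>+x. indicator S (vec_lambda x) \<partial>?P)"
    if [measurable]: "S \<in> sets borel" for S
  proof -
    have "(\<integral>\<^sup>+x. indicator S (vec_lambda x) \<partial>?P) = (\<integral>\<^sup>+\<omega>. indicator S (vec_lambda (\<lambda>i\<in>UNIV. Z \<omega> $ i)) \<partial>M)"
      unfolding law[symmetric]
    proof (rule nn_integral_distr)
      show "(\<lambda>\<omega>. \<lambda>i\<in>UNIV. Z \<omega> $ i) \<in> measurable M (PiM UNIV (\<lambda>_. borel))"
        by (intro measurable_restrict measurable_compose[OF ZM borel_measurable_nth])
      have "(\<lambda>x. indicator S (vec_lambda x) :: ennreal) \<in> borel_measurable ?P" by measurable
      then show "(\<lambda>x. indicator S (vec_lambda x) :: ennreal) \<in> borel_measurable 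
          (distr M (PiM UNIV (\<lambda>_. borel)) (\<lambda>\<omega>. \<lambda>i\<in>UNIV. Z \<omega> $ i))" unfolding law .
    qed
    also have "\<dots> = (\<integral>\<^sup>+\<omega>. indicator (Z -` S \<inter> space M) \<omega> \<partial>M)"
      by (intro nn_integral_cong) (simp add: indicator_def restrict_def)
    also have "\<dots> = emeasure M (Z -` S \<inter> space M)" by simp
    finally show ?thesis by simp
  qed
  have "(\<integral>\<^sup>+x. ennreal (exp (r\<^sup>2 / 4)) * indicator A (vec_lambda x) \<partial>?P) * (\<integral>\<^sup>+x. indicator B (vec_lambda x) \<partial>?P) \<le> 1"
  proof (rule gaussian_property_tau_PiM)
    fix x y :: "'n \<Rightarrow> real"
    have "exp (r\<^sup>2 / 4) \<le> exp ((\<Sum>i\<in>UNIV. (x i - y i)\<^sup>2) / 4)" if "vec_lambda x \<in> A" "vec_lambda y \<in> B"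
    proof -
      have "r\<^sup>2 \<le> (dist (vec_lambda x) (vec_lambda y))\<^sup>2"
        using sep[OF that] \<open>r \<ge> 0\<close> by (intro power_mono)
      also have "\<dots> = (\<Sum>i\<in>UNIV. (x i - y i)\<^sup>2)"
        by (simp add: dist_norm norm_vec_def L2_set_def sum_nonneg)
      finally show ?thesis by simp
    qed
    then show "ennreal (exp (r\<^sup>2 / 4)) * indicator A (vec_lambda x) * indicator B (vec_lambda y)
        \<le> ennreal (exp ((\<Sum>i\<in>UNIV. (x i - y i)\<^sup>2) / 4))"
      by (auto simp: indicator_def)
  qed auto
  also have "(\<integral>\<^sup>+x. ennreal (exp (r\<^sup>2 / 4)) * indicator A (vec_lambda x) \<partial>?P)
      = ennreal (exp (r\<^sup>2 / 4)) * (\<integral>\<^sup>+x. indicator A (vec_lambda x) \<partial>?P)"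
    by (rule nn_integral_cmult) measurable
  finally have "exp (r\<^sup>2 / 4) * (measure M (Z -` A \<inter> space M) * measure M (Z -` B \<inter> space M)) \<le> 1"
    by (simp add: em[symmetric] emeasure_eq_measure ennreal_mult[symmetric] mult.assoc)
  then show ?thesis by (simp add: exp_minus field_simps)
qed

section \<open>Exponential moments of linear functionals\<close>

text \<open>Multiplying the density by the exponential again gives a multiple of a centred Gaussian density, of
inverse variance \<open>1 / \<tau>\<^sup>2 - 3 / 4\<close>. The mass of this multiple is largest for \<open>\<tau> = 1\<close>, where it
is \<open>1 / sqrt (1 / 4) = 2\<close>.\<close>

lemma gaussian_exp_square:
  assumes "distributed M lborel W (normal_density 0 \<tau>)" "0 < \<tau>" "\<tau> \<le> 1"
  shows "(\<integral>\<^sup>+\<omega>. ennreal (exp (3 / 8 * (W \<omega>)\<^sup>2)) \<partial>M) \<le> 2"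
proof -
  define v where "v = 1 / \<tau>\<^sup>2 - 3 / 4"
  have "\<tau>\<^sup>2 \<le> 1" using assms by (simp add: power_le_one)
  then have "1 / \<tau>\<^sup>2 \<ge> 1" using assms by simp
  then have v: "v \<ge> 1 / (4 * \<tau>\<^sup>2)" "v > 0" unfolding v_def by auto
  have "normal_density 0 \<tau> x * exp (3 / 8 * x\<^sup>2) = 1 / (\<tau> * sqrt v) * normal_density 0 (1 / sqrt v) x" for x
  proof -
    have "- x\<^sup>2 / (2 * \<tau>\<^sup>2) + 3 / 8 * x\<^sup>2 = - x\<^sup>2 / (2 * (1 / sqrt v)\<^sup>2)"
      using v assms unfolding v_def by (simp add: field_simps power_divide)
    then have "exp (- x\<^sup>2 / (2 * \<tau>\<^sup>2)) * exp (3 / 8 * x\<^sup>2) = exp (- x\<^sup>2 / (2 * (1 / sqrt v)\<^sup>2))"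
      by (simp only: exp_add[symmetric])
    moreover have "1 / sqrt (2 * pi * \<tau>\<^sup>2) = 1 / (\<tau> * sqrt v) * (1 / sqrt (2 * pi * (1 / sqrt v)\<^sup>2))"
      using v assms by (simp add: real_sqrt_mult real_sqrt_divide power_divide)
    ultimately show ?thesis unfolding normal_density_def by simp
  qed
  note eq = this
  have "(\<integral>\<^sup>+\<omega>. ennreal (exp (3 / 8 * (W \<omega>)\<^sup>2)) \<partial>M)
      = (\<integral>\<^sup>+x. ennreal (normal_density 0 \<tau> x) * ennreal (exp (3 / 8 * x\<^sup>2)) \<partial>lborel)"
    by (rule distributed_nn_integral[OF assms(1), symmetric]) measurable
  also have "\<dots> = (\<integral>\<^sup>+x. ennreal (1 / (\<tau> * sqrt v)) * ennreal (normal_density 0 (1 / sqrt v) x) \<partial>lborel)"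
  proof (rule nn_integral_cong)
    fix x :: real
    show "ennreal (normal_density 0 \<tau> x) * ennreal (exp (3 / 8 * x\<^sup>2))
        = ennreal (1 / (\<tau> * sqrt v)) * ennreal (normal_density 0 (1 / sqrt v) x)"
      using v assms eq[of x] by (simp only: ennreal_mult[symmetric] normal_density_nonneg exp_ge_zero)
        (subst ennreal_mult[symmetric]; simp)
  qed
  also have "\<dots> = ennreal (1 / (\<tau> * sqrt v)) * (\<integral>\<^sup>+x. normal_density 0 (1 / sqrt v) x \<partial>lborel)"
    by (rule nn_integral_cmult) measurable
  also have "(\<integral>\<^sup>+x. normal_density 0 (1 / sqrt v) x \<partial>lborel) = ennreal (LINT x|lborel. normal_density 0 (1 / sqrt v) x)"
    using v by (intro nn_integral_eq_integral) auto
  also have "ennreal (1 / (\<tau> * sqrt v)) * ennreal (LINT x|lborel. normal_density 0 (1 / sqrt v) x) \<le> ennreal 2"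
  proof -
    have "1 / (2 * \<tau>) \<le> sqrt v" using v(1) assms by (intro real_le_rsqrt) (simp add: power_divide)
    then have "1 / (\<tau> * sqrt v) \<le> 2" using assms v by (simp add: field_simps)
    then have "ennreal (1 / (\<tau> * sqrt v)) \<le> ennreal 2" by (rule ennreal_leI)
    then show ?thesis using v by simp
  qed
  finally show ?thesis by simp
qed

lemma gaussian_linear_exp_square:
  fixes Z :: "'a \<Rightarrow> real ^ 'n" and a :: "real ^ 'n"
  assumes "prob_space M" and Z: "gaussian_noise M 1 Z" and "norm a \<le> 1"
  shows "(\<integral>\<^sup>+\<omega>. ennreal (exp (3 / 8 * (a \<bullet> Z \<omega>)\<^sup>2)) \<partial>M) \<le> 2"
proof (cases "a = 0")
  interpret prob_space M by fact
  case True
  then show ?thesis by (simp add: emeasure_space_1)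
next
  case False
  interpret prob_space M by fact
  define I where "I = {i. a $ i \<noteq> 0}"
  have I: "I \<noteq> {}" using False by (auto simp: I_def vec_eq_iff)
  have na: "norm a = sqrt (\<Sum>i\<in>I. \<bar>a $ i\<bar>\<^sup>2)"
    unfolding norm_vec_def L2_set_def I_def by (auto intro!: sum.mono_neutral_right)
  have "distributed M lborel (\<lambda>\<omega>. \<Sum>i\<in>I. a $ i * Z \<omega> $ i) (normal_density (\<Sum>i\<in>I. 0) (sqrt (\<Sum>i\<in>I. \<bar>a $ i\<bar>\<^sup>2)))"
  proof (rule sum_indep_normal)
    show "indep_vars (\<lambda>_. borel) (\<lambda>i \<omega>. a $ i * Z \<omega> $ i) I"
      using Z unfolding gaussian_noise_def
      by (intro indep_vars_compose2[where Y="\<lambda>i x. a $ i * x"] indep_vars_subset[of _ _ UNIV I]) auto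
    fix i assume "i \<in> I"
    then have ai: "a $ i \<noteq> 0" by (simp add: I_def)
    then show "0 < \<bar>a $ i\<bar>" by simp
    have "distributed M lborel (\<lambda>\<omega>. 0 + a $ i * Z \<omega> $ i) (normal_density (0 + a $ i * 0) (\<bar>a $ i\<bar> * 1))"
      using Z ai unfolding gaussian_noise_def by (intro normal_density_affine) auto
    then show "distributed M lborel (\<lambda>\<omega>. a $ i * Z \<omega> $ i) (normal_density 0 \<bar>a $ i\<bar>)" by simp
  qed (use I in auto)
  also have "(\<lambda>\<omega>. \<Sum>i\<in>I. a $ i * Z \<omega> $ i) = (\<lambda>\<omega>. a \<bullet> Z \<omega>)"
    unfolding inner_vec_def I_def by (auto simp: fun_eq_iff intro!: sum.mono_neutral_left)
  finally have "distributed M lborel (\<lambda>\<omega>. a \<bullet> Z \<omega>) (normal_density 0 (norm a))"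
    by (simp only: na sum.neutral_const)
  then show ?thesis using False assms(3) by (intro gaussian_exp_square) auto
qed

section \<open>Measurability of events that quantify over all estimators\<close>

text \<open>Projections of Borel sets need not be Borel, but an open set of a Euclidean space is a countable
union of compact sets, so the set projected here is one as well, and continuous images of compact
sets are compact. The events below speak about all minimizers, all sparse vectors and all means \<open>f\<close>;
their complements are projections of this kind.\<close>

lemma borel_projection_closed_Int_open:
  fixes C U :: "('a::euclidean_space \<times> 'b::euclidean_space) set"
  assumes "closed C" "open U"
  shows "{x. \<exists>y. (x, y) \<in> C \<inter> U} \<in> sets borel"
proof -
  obtain K :: "nat \<Rightarrow> ('a \<times> 'b) set" where K: "\<And>n. compact (K n)" "\<And>n. K n \<subseteq> U" "(\<Union>n. K n) = U"
    by (rule open_Union_compact_subsets[OF \<open>open U\<close>]) blast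
  have "{x. \<exists>y. (x, y) \<in> C \<inter> U} = fst ` (C \<inter> (\<Union>n. K n))"
    unfolding K(3) by (simp add: set_eq_iff image_iff Bex_def)
  also have "\<dots> = (\<Union>n::nat. fst ` (C \<inter> K n))" by blast
  finally have "{x. \<exists>y. (x, y) \<in> C \<inter> U} = (\<Union>n::nat. fst ` (C \<inter> K n))" .
  moreover have "fst ` (C \<inter> K n) \<in> sets borel" for n
  proof -
    have "compact (C \<inter> K n)" using \<open>closed C\<close> K(1) by (rule closed_Int_compact)
    then show ?thesis
      by (intro borel_closed compact_imp_closed compact_continuous_image continuous_intros)
  qed
  ultimately show ?thesis by auto
qed

lemma emp_norm_eq: "emp_norm (u :: real ^ 'n) = norm u / sqrt (real CARD('n))"
  unfolding emp_norm_def norm_vec_def L2_set_def by (simp add: real_sqrt_divide)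

lemma emp_norm_sq: "(emp_norm (u :: real ^ 'n))\<^sup>2 = (u \<bullet> u) / real CARD('n)"
  unfolding emp_norm_eq by (simp add: power_divide power2_norm_eq_inner)

lemma continuous_on_lq_norm [continuous_intros]:
  fixes g :: "'a::topological_space \<Rightarrow> real ^ 'p"
  assumes "continuous_on S g" "1 \<le> q"
  shows "continuous_on S (\<lambda>x. lq_norm q (g x))"
  unfolding lq_norm_def using assms
  by (intro continuous_intros continuous_on_powr') (auto intro: sum_nonneg)

lemma continuous_on_emp_norm [continuous_intros]:
  fixes g :: "'a::topological_space \<Rightarrow> real ^ 'n"
  assumes "continuous_on S g"
  shows "continuous_on S (\<lambda>x. emp_norm (g x))"
  unfolding emp_norm_eq using assms by (intro continuous_intros) auto

lemma continuous_on_matrix_vector_mult [continuous_intros]: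
  fixes X :: "real ^ 'p ^ 'n"
  assumes "continuous_on S g"
  shows "continuous_on S (\<lambda>x. X *v g x)"
  using continuous_on_compose2[OF linear_continuous_on assms, of "(*v) X" UNIV]
    matrix_vector_mul_bounded_linear by auto

lemma closed_is_lasso:
  fixes X :: "real ^ 'p ^ 'n" and y :: "'a::topological_space \<Rightarrow> real ^ 'n" and bhat :: "'a \<Rightarrow> real ^ 'p"
  assumes "continuous_on UNIV y" "continuous_on UNIV bhat"
  shows "closed {x. is_lasso X lam (y x) (bhat x)}"
  unfolding is_lasso_def is_arg_min_def using assms
  by (auto simp: not_less intro!: closed_Collect_all closed_Collect_le continuous_intros)

lemma closed_l0_norm_le: "closed {b :: real ^ 'p. l0_norm b \<le> s}"
proof -
  have "{b :: real ^ 'p. l0_norm b \<le> s} = (\<Union>S\<in>{S. card S \<le> s}. {b. \<forall>j. j \<notin> S \<longrightarrow> b $ j = 0})"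
    (is "?L = ?R")
  proof (intro equalityI subsetI)
    fix b assume "b \<in> ?L"
    then show "b \<in> ?R" by (intro UN_I[of "{j. b $ j \<noteq> 0}"]) (auto simp: l0_norm_def)
  next
    fix b assume "b \<in> ?R"
    then obtain S where "card S \<le> s" "\<forall>j. j \<notin> S \<longrightarrow> b $ j = 0" by auto
    then have "card {j. b $ j \<noteq> 0} \<le> card S" by (intro card_mono) auto
    then show "b \<in> ?L" using \<open>card S \<le> s\<close> by (simp add: l0_norm_def)
  qed
  also have "closed \<dots>"
    by (intro closed_UN ballI closed_Collect_all closed_Collect_imp closed_Collect_eq continuous_intros) auto
  finally show ?thesis .
qed

lemma prediction_event_borel:
  fixes X :: "real ^ 'p ^ 'n"
  shows "{x. \<forall>(f :: real ^ 'n) (b :: real ^ 'p) (bhat :: real ^ 'p).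
            is_lasso X lam (f + x) bhat \<longrightarrow> l0_norm b \<le> s \<longrightarrow>
            lam / 2 * lq_norm 1 (bhat - b) + (emp_norm (X *v bhat - f))\<^sup>2
              \<le> (emp_norm (X *v b - f))\<^sup>2 + c} \<in> sets borel" (is "?E \<in> _")
proof -
  let ?C = "{z :: (real ^ 'n) \<times> (real ^ 'n) \<times> (real ^ 'p) \<times> (real ^ 'p).
      is_lasso X lam (fst (snd z) + fst z) (snd (snd (snd z)))} \<inter> {z. l0_norm (fst (snd (snd z))) \<le> s}"
  let ?U = "{z :: (real ^ 'n) \<times> (real ^ 'n) \<times> (real ^ 'p) \<times> (real ^ 'p).
      (emp_norm (X *v fst (snd (snd z)) - fst (snd z)))\<^sup>2 + c
      < lam / 2 * lq_norm 1 (snd (snd (snd z)) - fst (snd (snd z))) + (emp_norm (X *v snd (snd (snd z)) - fst (snd z)))\<^sup>2}"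
  have "closed {z :: (real ^ 'n) \<times> (real ^ 'n) \<times> (real ^ 'p) \<times> (real ^ 'p). l0_norm (fst (snd (snd z))) \<le> s}"
    using continuous_closed_vimage[OF closed_l0_norm_le[of s], of "\<lambda>z :: (real ^ 'n) \<times> (real ^ 'n) \<times> (real ^ 'p) \<times> (real ^ 'p). fst (snd (snd z))"]
    by (auto simp: vimage_def intro: continuous_intros)
  then have "closed ?C" by (intro closed_Int closed_is_lasso continuous_intros)
  moreover have "open ?U" by (intro open_Collect_less continuous_intros) auto
  ultimately have "{x. \<exists>y. (x, y) \<in> ?C \<inter> ?U} \<in> sets borel" by (rule borel_projection_closed_Int_open)
  moreover have "?E = - {x. \<exists>y. (x, y) \<in> ?C \<inter> ?U}"
    by (simp add: set_eq_iff not_less) blast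
  ultimately show ?thesis by (simp add: borel_comp)
qed

lemma estimation_event_borel:
  fixes X :: "real ^ 'p ^ 'n"
  assumes "1 \<le> q"
  shows "{x. \<forall>bhat :: real ^ 'p. is_lasso X lam (X *v bstar + x) bhat \<longrightarrow> lq_norm q (bhat - bstar) \<le> c}
    \<in> sets borel" (is "?E \<in> _")
proof -
  let ?C = "{z :: (real ^ 'n) \<times> (real ^ 'p). is_lasso X lam (X *v bstar + fst z) (snd z)}"
  let ?U = "{z :: (real ^ 'n) \<times> (real ^ 'p). c < lq_norm q (snd z - bstar)}"
  have "closed ?C" by (intro closed_is_lasso continuous_intros)
  moreover have "open ?U" by (intro open_Collect_less continuous_intros assms)
  ultimately have "{x. \<exists>y. (x, y) \<in> ?C \<inter> ?U} \<in> sets borel" by (rule borel_projection_closed_Int_open)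
  moreover have "?E = - {x. \<exists>y. (x, y) \<in> ?C \<inter> ?U}"
    by (auto simp add: not_less)
  ultimately show ?thesis by (simp add: borel_comp)
qed

section \<open>The Lasso and the restricted eigenvalue constant\<close>

text \<open>Plain optimality of \<open>bhat\<close> against \<open>b\<close> would miss the term \<open>(emp_norm (X *v (bhat - b)))\<^sup>2\<close> on the left,
which the rest of the argument needs in order to absorb the noise. It comes from first-order
optimality: moving from \<open>bhat\<close> a fraction \<open>\<epsilon>\<close> of the way to \<open>b\<close> does not decrease the
objective, the \<open>\<ell>\<^sub>1\<close> part is convex, and \<open>\<epsilon>\<close> tends to zero.\<close>

lemma lasso_basic_inequality:
  fixes X :: "real ^ 'p ^ 'n" and f xi :: "real ^ 'n" and b bhat :: "real ^ 'p"
  assumes lasso: "is_lasso X lam (f + xi) bhat" and "lam \<ge> 0"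
  shows "(emp_norm (X *v bhat - f))\<^sup>2 + (emp_norm (X *v (bhat - b)))\<^sup>2
    \<le> (emp_norm (X *v b - f))\<^sup>2 + 2 * ((xi \<bullet> (X *v (bhat - b))) / real CARD('n))
      + 2 * lam * (lq_norm 1 b - lq_norm 1 bhat)"
proof -
  define n where "n = real CARD('n)"
  have n: "n > 0" unfolding n_def by simp
  define A where "A = X *v bhat - (f + xi)"
  define D where "D = X *v b - X *v bhat"
  define K where "K = 2 * ((A \<bullet> D) / n) + 2 * lam * (lq_norm 1 b - lq_norm 1 bhat)"
  define P where "P = (D \<bullet> D) / n"
  have P: "P \<ge> 0" using n unfolding P_def by simp
  have step: "0 \<le> K + \<epsilon> * P" if \<epsilon>: "0 < \<epsilon>" "\<epsilon> \<le> 1" for \<epsilon>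
  proof -
    define c where "c = bhat + \<epsilon> *\<^sub>R (b - bhat)"
    have Xc: "X *v c - (f + xi) = A + \<epsilon> *\<^sub>R D"
      unfolding c_def A_def D_def
      by (simp add: matrix_vector_right_distrib matrix_vector_mult_diff_distrib scaleR_matrix_vector_assoc[symmetric]
          matrix_vector_mult_scaleR algebra_simps)
    have "lq_norm 1 c \<le> (\<Sum>j\<in>UNIV. (1 - \<epsilon>) * \<bar>bhat $ j\<bar> + \<epsilon> * \<bar>b $ j\<bar>)"
      unfolding lq_norm_1
    proof (rule sum_mono)
      fix j
      have "c $ j = (1 - \<epsilon>) * bhat $ j + \<epsilon> * b $ j" unfolding c_def by (simp add: algebra_simps)
      also have "\<bar>\<dots>\<bar> \<le> \<bar>(1 - \<epsilon>) * bhat $ j\<bar> + \<bar>\<epsilon> * b $ j\<bar>" by (rule abs_triangle_ineq)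
      finally show "\<bar>c $ j\<bar> \<le> (1 - \<epsilon>) * \<bar>bhat $ j\<bar> + \<epsilon> * \<bar>b $ j\<bar>" using \<epsilon> by (simp add: abs_mult)
    qed
    also have "\<dots> = (1 - \<epsilon>) * lq_norm 1 bhat + \<epsilon> * lq_norm 1 b"
      by (simp add: lq_norm_1 sum.distrib sum_distrib_left)
    finally have conv: "2 * lam * lq_norm 1 c \<le> 2 * lam * ((1 - \<epsilon>) * lq_norm 1 bhat + \<epsilon> * lq_norm 1 b)"
      using \<open>lam \<ge> 0\<close> by (intro mult_left_mono) auto
    have "(emp_norm (X *v bhat - (f + xi)))\<^sup>2 + 2 * lam * lq_norm 1 bhat
        \<le> (emp_norm (X *v c - (f + xi)))\<^sup>2 + 2 * lam * lq_norm 1 c"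
      using lasso unfolding is_lasso_def is_arg_min_def by (auto simp: not_less)
    then have "(A \<bullet> A) / n + 2 * lam * lq_norm 1 bhat
        \<le> ((A + \<epsilon> *\<^sub>R D) \<bullet> (A + \<epsilon> *\<^sub>R D)) / n + 2 * lam * lq_norm 1 c"
      unfolding emp_norm_sq Xc n_def[symmetric] A_def[symmetric] .
    also have "((A + \<epsilon> *\<^sub>R D) \<bullet> (A + \<epsilon> *\<^sub>R D)) / n = (A \<bullet> A) / n + \<epsilon> * (2 * ((A \<bullet> D) / n)) + \<epsilon> * (\<epsilon> * P)"
      unfolding P_def using n
      by (simp add: inner_add_left inner_add_right inner_commute[of D A] field_simps)
    finally have "0 \<le> \<epsilon> * (K + \<epsilon> * P)"
      using conv unfolding K_def by (simp add: algebra_simps)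
    then show ?thesis using \<epsilon> by (simp add: zero_le_mult_iff)
  qed
  have "K \<ge> 0"
  proof (rule ccontr)
    assume "\<not> K \<ge> 0"
    then have K: "K < 0" by simp
    (* any fraction with 0 < e <= 1 and e * P < - K contradicts the inequality just proved *)
    let ?e = "- K / (P + 1 - K)"
    have "?e * P < - K" using K P by (simp add: field_simps mult_neg_pos)
    moreover have "0 < ?e" "?e \<le> 1" using K P by (auto simp: field_simps)
    ultimately show False using step[of ?e] by linarith
  qed
  define e where "e = X *v bhat - f"
  have "X *v b - f = e + D" "X *v (bhat - b) = - D" "A = e - xi"
    unfolding D_def A_def e_def by (simp_all add: matrix_vector_mult_diff_distrib)
  moreover have "(e + D) \<bullet> (e + D) = e \<bullet> e + 2 * (e \<bullet> D) + D \<bullet> D"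
    by (simp add: inner_add_left inner_add_right inner_commute)
  moreover have "(e - xi) \<bullet> D = e \<bullet> D - xi \<bullet> D" by (rule inner_diff_left)
  ultimately show ?thesis
    using \<open>K \<ge> 0\<close> unfolding K_def emp_norm_sq n_def[symmetric] e_def[symmetric]
    by (simp add: add_divide_distrib diff_divide_distrib right_diff_distrib)
qed

lemma l1_norm_split: "lq_norm 1 u = (\<Sum>j\<in>S. \<bar>u $ j\<bar>) + (\<Sum>j\<in>-S. \<bar>u $ j\<bar>)"
  for u :: "real ^ 'p"
  unfolding lq_norm_1 by (subst sum.union_disjoint[symmetric]) (auto simp: Compl_partition)

lemma l1_norm_diff_le_support:
  fixes b c :: "real ^ 'p"
  defines "S \<equiv> {j. b $ j \<noteq> 0}"
  shows "lq_norm 1 b - lq_norm 1 c \<le> (\<Sum>j\<in>S. \<bar>(c - b) $ j\<bar>) - (\<Sum>j\<in>-S. \<bar>(c - b) $ j\<bar>)"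
proof -
  have "(\<Sum>j\<in>S. \<bar>b $ j\<bar>) - (\<Sum>j\<in>S. \<bar>c $ j\<bar>) \<le> (\<Sum>j\<in>S. \<bar>(c - b) $ j\<bar>)"
    unfolding sum_subtractf[symmetric] by (intro sum_mono) auto
  moreover have "(\<Sum>j\<in>-S. \<bar>b $ j\<bar>) = 0" "(\<Sum>j\<in>-S. \<bar>(c - b) $ j\<bar>) = (\<Sum>j\<in>-S. \<bar>c $ j\<bar>)"
    by (auto simp: S_def)
  ultimately show ?thesis unfolding l1_norm_split[of b S] l1_norm_split[of c S] by simp
qed

lemma sum_abs_le_sqrt_card:
  fixes u :: "real ^ 'p"
  assumes "card S \<le> s"
  shows "(\<Sum>j\<in>S. \<bar>u $ j\<bar>) \<le> sqrt (real s) * norm u"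
proof -
  have "(\<Sum>j\<in>S. \<bar>1\<bar> * \<bar>u $ j\<bar>) \<le> L2_set (\<lambda>_. 1) S * L2_set (\<lambda>j. u $ j) S"
    by (rule L2_set_mult_ineq)
  also have "\<dots> \<le> sqrt (real s) * norm u"
    unfolding norm_vec_def L2_set_def using assms
    by (intro mult_mono real_sqrt_le_mono) (auto simp: sum_nonneg intro!: sum_mono2)
  finally show ?thesis by simp
qed

lemma theta_cone_le:
  fixes X :: "real ^ 'p ^ 'n"
  assumes "d \<in> cone_SRE s c0"
  shows "theta X s c0 * norm d \<le> emp_norm (X *v d)"
proof (cases "d = 0")
  case False
  have "bdd_below ((\<lambda>d. emp_norm (X *v d) / lq_norm 2 d) ` (cone_SRE s c0 - {0}))"
    by (intro bdd_belowI2[of _ 0]) (auto simp: lq_norm_2 emp_norm_eq)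
  then have "theta X s c0 \<le> emp_norm (X *v d) / lq_norm 2 d"
    unfolding theta_def using assms False by (intro cINF_lower) auto
  then show ?thesis using False by (simp add: lq_norm_2 pos_le_divide_eq)
qed (simp add: emp_norm_eq)

lemma theta_le_1:
  fixes X :: "real ^ 'p ^ 'n"
  assumes "SRE X s c0" "1 \<le> s" "0 \<le> c0"
  shows "theta X s c0 \<le> 1"
proof -
  fix j :: 'p
  have "1 * 1 \<le> (1 + c0) * sqrt (real s)" using assms by (intro mult_mono) auto
  moreover have "(\<Sum>k\<in>UNIV. \<bar>(axis j 1 :: real ^ 'p) $ k\<bar>) = 1"
    by (simp add: axis_def if_distrib[of abs] cong: if_cong)
  ultimately have "axis j 1 \<in> cone_SRE s c0"
    unfolding cone_SRE_def lq_norm_1 lq_norm_2 by simp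
  from theta_cone_le[OF this, of X] show ?thesis
    using assms unfolding SRE_def by (auto intro: order_trans)
qed

section \<open>Control of the noise by an exponential moment\<close>

text \<open>The vector \<open>w\<close> plays the role of the correlations of the noise with the columns of the design. The
moment condition limits both the number of coordinates with \<open>3 / 8 * (w $ j)\<^sup>2 > L\<close> (at most \<open>s\<close>) and,
through the tangent of \<open>exp\<close> at \<open>L\<close>, the sum of squares over at most \<open>2 * s\<close> coordinates. The large
coordinates can thus be added to the support \<open>S\<close> and handled by the Cauchy-Schwarz inequality,
whereas the others are bounded uniformly. The constant \<open>12 / 5\<close> is a rational upper bound of \<open>sqrt (16 / 3)\<close>.\<close>

lemma exp_moment_inner_bound:
  fixes w u :: "real ^ 'p"
  assumes s: "1 \<le> s" "card S \<le> s" and L: "1 \<le> L"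
    and expL: "exp L = 2 * exp 1 * real CARD('p) / real s"
    and moment: "(\<Sum>j\<in>UNIV. exp (3 / 8 * (w $ j)\<^sup>2)) \<le> 4 * real CARD('p)"
  shows "w \<bullet> u \<le> 12 / 5 * sqrt L * (sqrt (real s) * norm u + (\<Sum>j\<in>-S. \<bar>u $ j\<bar>))"
proof -
  let ?\<eta> = "\<lambda>j. 3 / 8 * (w $ j)\<^sup>2"
  define B where "B = {j. L < ?\<eta> j}"
  have "real s * exp L = exp 1 * (2 * real CARD('p))" using s expL by (simp add: field_simps)
  moreover have "2 * (2 * real CARD('p)) \<le> exp 1 * (2 * real CARD('p))"
    using exp_ge_add_one_self[of "1::real"] by (intro mult_right_mono) auto
  ultimately have total: "(\<Sum>j\<in>UNIV. exp (?\<eta> j)) \<le> real s * exp L" using moment by linarith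
  have sub: "(\<Sum>j\<in>T. exp (?\<eta> j)) \<le> real s * exp L" for T :: "'p set"
    using total by (rule order_trans[rotated]) (auto intro!: sum_mono2)
  have "real (card B) * exp L \<le> (\<Sum>j\<in>B. exp (?\<eta> j))"
    unfolding B_def by (intro sum_bounded_below[of _ "exp L", simplified]) auto
  from order_trans[OF this sub] have "card B \<le> s" by simp
  let ?T = "S \<union> B"
  have cardT: "card ?T \<le> 2 * s" using card_Un_le[of S B] \<open>card B \<le> s\<close> s by linarith
  (* the tangent line exp L * (1 + (v - L)) lies below exp v *)
  have "exp L * (\<Sum>j\<in>?T. ?\<eta> j - (L - 1)) \<le> (\<Sum>j\<in>?T. exp (?\<eta> j))"
    unfolding sum_distrib_left
  proof (rule sum_mono)
    fix j
    have "exp L * (1 + (?\<eta> j - L)) \<le> exp L * exp (?\<eta> j - L)"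
      by (intro mult_left_mono exp_ge_add_one_self) auto
    then show "exp L * (?\<eta> j - (L - 1)) \<le> exp (?\<eta> j)" by (simp add: exp_add[symmetric] algebra_simps)
  qed
  also have "\<dots> \<le> exp L * real s" using sub[of ?T] by (simp add: mult.commute)
  finally have "(\<Sum>j\<in>?T. ?\<eta> j) - real (card ?T) * (L - 1) \<le> real s"
    by (simp add: sum_subtractf)
  moreover have "real (card ?T) * (L - 1) \<le> real (2 * s) * (L - 1)"
    using cardT L by (intro mult_right_mono) linarith+
  ultimately have "(\<Sum>j\<in>?T. ?\<eta> j) \<le> 2 * real s * L" using s by (simp add: algebra_simps)
  then have "3 / 8 * (\<Sum>j\<in>?T. (w $ j)\<^sup>2) \<le> 2 * real s * L" by (simp only: sum_distrib_left)
  then have "(\<Sum>j\<in>?T. (w $ j)\<^sup>2) \<le> 16 / 3 * (real s * L)" by simp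
  also have "\<dots> \<le> (12 / 5)\<^sup>2 * (real s * L)" using L by (intro mult_right_mono) (auto simp: power2_eq_square)
  finally have "L2_set (\<lambda>j. w $ j) ?T \<le> sqrt ((12 / 5)\<^sup>2 * (real s * L))"
    unfolding L2_set_def by (rule real_sqrt_le_mono)
  then have wT: "L2_set (\<lambda>j. w $ j) ?T \<le> 12 / 5 * sqrt L * sqrt (real s)"
    by (simp add: real_sqrt_mult mult.commute mult.left_commute)
  have "w \<bullet> u \<le> (\<Sum>j\<in>UNIV. \<bar>w $ j\<bar> * \<bar>u $ j\<bar>)"
    unfolding inner_vec_def by (intro sum_mono) (simp add: abs_mult[symmetric])
  also have "\<dots> = (\<Sum>j\<in>?T. \<bar>w $ j\<bar> * \<bar>u $ j\<bar>) + (\<Sum>j\<in>-?T. \<bar>w $ j\<bar> * \<bar>u $ j\<bar>)"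
    by (subst sum.union_disjoint[symmetric]) (auto simp: Compl_partition intro!: sum.cong)
  also have "(\<Sum>j\<in>?T. \<bar>w $ j\<bar> * \<bar>u $ j\<bar>) \<le> L2_set (\<lambda>j. w $ j) ?T * L2_set (\<lambda>j. u $ j) ?T"
    by (rule L2_set_mult_ineq)
  also have "\<dots> \<le> 12 / 5 * sqrt L * sqrt (real s) * norm u"
  proof (rule mult_mono[OF wT])
    show "L2_set (\<lambda>j. u $ j) ?T \<le> norm u"
      unfolding norm_vec_def L2_set_def by (auto intro!: real_sqrt_le_mono sum_mono2)
  qed (use L in auto)
  also have "(\<Sum>j\<in>-?T. \<bar>w $ j\<bar> * \<bar>u $ j\<bar>) \<le> (\<Sum>j\<in>-?T. 12 / 5 * sqrt L * \<bar>u $ j\<bar>)"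
  proof (intro sum_mono mult_right_mono)
    fix j assume "j \<in> - ?T"
    then have "(w $ j)\<^sup>2 \<le> 8 / 3 * L" unfolding B_def by auto
    also have "\<dots> \<le> (12 / 5)\<^sup>2 * L" using L by (intro mult_right_mono) (auto simp: power2_eq_square)
    finally have "sqrt ((w $ j)\<^sup>2) \<le> sqrt ((12 / 5)\<^sup>2 * L)" by (rule real_sqrt_le_mono)
    then show "\<bar>w $ j\<bar> \<le> 12 / 5 * sqrt L" by (simp add: real_sqrt_mult)
  qed auto
  also have "\<dots> \<le> (\<Sum>j\<in>-S. 12 / 5 * sqrt L * \<bar>u $ j\<bar>)"
    using L by (intro sum_mono2) auto
  also have "\<dots> = 12 / 5 * sqrt L * (\<Sum>j\<in>-S. \<bar>u $ j\<bar>)" by (rule sum_distrib_left[symmetric])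
  finally show ?thesis by (simp only: distrib_left mult.assoc)
qed

section \<open>Deterministic risk bounds on a good noise event\<close>

text \<open>The real arithmetic of the prediction bound: \<open>U\<close> and \<open>R\<close> are the \<open>\<ell>\<^sub>1\<close> norms of the error on and off the
support, \<open>m\<close> is \<open>sqrt s\<close> times its Euclidean norm, \<open>x\<close> its prediction norm, \<open>h = sqrt s / \<theta>\<close>, and \<open>N\<close> is the
noise term. If \<open>R\<close> dominates, its negative coefficient outweighs everything except the \<open>h * x\<close> part
of the noise; otherwise the error lies in the cone and \<open>m \<le> h * x\<close>. In both cases what remains is at
most \<open>7 / 2 * lam * h * x - x\<^sup>2\<close>, and completing the square gives the constant \<open>49 / 16\<close>.\<close>

lemma oracle_inequality_scalar:
  fixes lam :: real
  assumes nonneg: "0 \<le> lam" "0 \<le> m" "0 \<le> R" "0 \<le> h" "0 \<le> x"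
    and U: "U \<le> m"
    and basic: "E1 + x\<^sup>2 \<le> E0 + 2 * N + 2 * lam * (U - R)"
    and \<kappa>: "54 / 5 * \<kappa> \<le> lam"
    and noise: "N \<le> \<kappa> * (12 / 5 * (m + R) + 3 * (h * x))"
    and cone: "U + R \<le> 8 * m \<Longrightarrow> m \<le> h * x"
  shows "lam / 2 * (U + R) + E1 \<le> E0 + 49 * lam\<^sup>2 * h\<^sup>2 / 16"
proof -
  have hx: "0 \<le> h * x" using nonneg by simp
  have "\<kappa> * (12 / 5 * (m + R) + 3 * (h * x)) \<le> (5 / 54 * lam) * (12 / 5 * (m + R) + 3 * (h * x))"
    using \<kappa> nonneg hx by (intro mult_right_mono) auto
  then have "2 * N \<le> 2 * ((5 / 54 * lam) * (12 / 5 * (m + R) + 3 * (h * x)))" using noise by linarith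
  also have "\<dots> = lam * (4 / 9 * (m + R) + 5 / 9 * (h * x))" by (simp add: field_simps)
  finally have N: "2 * N \<le> lam * (4 / 9 * (m + R) + 5 / 9 * (h * x))" .
  define g where "g = h * x"
  have "5 / 2 * U - 3 / 2 * R + (4 / 9 * (m + R) + 5 / 9 * g) \<le> 7 / 2 * g"
  proof (cases "U + R \<le> 8 * m")
    case True
    then have "m \<le> g" unfolding g_def by (rule cone)
    then show ?thesis using U nonneg(3) by (simp add: field_simps)
  next
    case False
    then show ?thesis using U nonneg(2) hx unfolding g_def[symmetric] by (simp add: field_simps)
  qed
  then have bracket: "lam * (5 / 2 * U - 3 / 2 * R + (4 / 9 * (m + R) + 5 / 9 * (h * x))) \<le> lam * (7 / 2 * (h * x))"
    using nonneg unfolding g_def by (intro mult_left_mono)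
  have "lam / 2 * (U + R) + (2 * N + 2 * lam * (U - R)) = lam * (5 / 2 * U - 3 / 2 * R) + 2 * N"
    by (simp add: field_simps)
  also have "\<dots> \<le> lam * (5 / 2 * U - 3 / 2 * R) + lam * (4 / 9 * (m + R) + 5 / 9 * (h * x))"
    by (rule add_left_mono[OF N])
  also have "\<dots> = lam * (5 / 2 * U - 3 / 2 * R + (4 / 9 * (m + R) + 5 / 9 * (h * x)))"
    by (rule distrib_left[symmetric])
  also note bracket
  also have "lam * (7 / 2 * (h * x)) = 7 / 2 * (lam * h) * x" by simp
  finally have "lam / 2 * (U + R) + (2 * N + 2 * lam * (U - R)) \<le> 7 / 2 * (lam * h) * x" .
  moreover have "7 / 2 * (lam * h) * x - x\<^sup>2 \<le> 49 * lam\<^sup>2 * h\<^sup>2 / 16"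
    using zero_le_power2[of "7 / 4 * (lam * h) - x"] by (simp add: power2_eq_square algebra_simps)
  ultimately show ?thesis using basic by linarith
qed

text \<open>Interpolation between the \<open>\<ell>\<^sub>1\<close> and the \<open>\<ell>\<^sub>2\<close> bound. After division by \<open>c\<close>, Young's inequality
\<open>v powr q \<le> (2 - q) * v + (q - 1) * v\<^sup>2\<close>, summed over the coordinates, splits
the \<open>q\<close>-th power into these two norms.\<close>

lemma lq_norm_interpolate:
  fixes u :: "real ^ 'p"
  assumes q: "1 \<le> q" "q \<le> 2" and "0 < c" "0 \<le> s"
    and l1: "lq_norm 1 u \<le> c * s" and l2: "norm u \<le> c * sqrt s"
  shows "lq_norm q u \<le> c * s powr (1 / q)"
proof -
  have young: "v powr q \<le> (2 - q) * v + (q - 1) * v\<^sup>2" if "0 \<le> v" for v :: real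
  proof (cases "v = 0")
    case False
    with that have v: "v > 0" by simp
    have "v powr (2 - q) * (v\<^sup>2) powr (q - 1) \<le> (2 - q) * v + (q - 1) * v\<^sup>2"
      using q v by (intro Youngs_inequality_0) auto
    moreover have "v powr (2 - q) * (v\<^sup>2) powr (q - 1) = v powr q"
      using v by (simp add: powr_powr powr_add[symmetric] flip: powr_numeral)
    ultimately show ?thesis by simp
  qed (use q in auto)
  let ?v = "\<lambda>j. \<bar>u $ j\<bar> / c"
  have scale: "(\<Sum>j\<in>UNIV. \<bar>u $ j\<bar> powr q) = c powr q * (\<Sum>j\<in>UNIV. ?v j powr q)"
    using \<open>0 < c\<close> by (simp add: sum_distrib_left powr_divide)
  have "(\<Sum>j\<in>UNIV. ?v j powr q) \<le> (\<Sum>j\<in>UNIV. (2 - q) * ?v j + (q - 1) * (?v j)\<^sup>2)"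
    using \<open>0 < c\<close> by (intro sum_mono young) auto
  also have "\<dots> = (2 - q) * (lq_norm 1 u / c) + (q - 1) * ((norm u)\<^sup>2 / c\<^sup>2)"
    by (simp add: sum.distrib sum_distrib_left[symmetric] sum_divide_distrib[symmetric] lq_norm_1 power_divide
        norm_vec_def L2_set_def sum_nonneg)
  also have "\<dots> \<le> (2 - q) * s + (q - 1) * s"
  proof (intro add_mono mult_left_mono)
    show "lq_norm 1 u / c \<le> s" using l1 \<open>0 < c\<close> by (simp add: field_simps)
    have "(norm u)\<^sup>2 \<le> (c * sqrt s)\<^sup>2" using l2 by (intro power_mono) auto
    then show "(norm u)\<^sup>2 / c\<^sup>2 \<le> s" using \<open>0 < c\<close> \<open>0 \<le> s\<close> by (simp add: field_simps power_mult_distrib)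
  qed (use q in auto)
  also have "\<dots> = s" by (simp add: algebra_simps)
  finally have "(\<Sum>j\<in>UNIV. \<bar>u $ j\<bar> powr q) \<le> c powr q * s"
    unfolding scale by (intro mult_left_mono) auto
  then have "lq_norm q u \<le> (c powr q * s) powr (1 / q)"
    unfolding lq_norm_def using q by (intro powr_mono2) (auto simp: sum_nonneg)
  also have "\<dots> = c * s powr (1 / q)"
    using q \<open>0 < c\<close> \<open>0 \<le> s\<close> by (simp add: powr_mult powr_powr)
  finally show ?thesis .
qed

section \<open>The good noise event\<close>

text \<open>The set \<open>A\<close> of points with small exponential moment has probability at least \<open>1 / 2\<close> by Markov's
inequality, since each summand has expectation at most \<open>2\<close>. The concentration bound then applies
to \<open>A\<close> and the set of points at distance at least \<open>r\<close> from it.\<close>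

lemma gaussian_moment_neighbourhood:
  fixes Z :: "'a \<Rightarrow> real ^ 'n" and a :: "'p::finite \<Rightarrow> real ^ 'n"
  assumes "prob_space M" and Z: "gaussian_noise M 1 Z" and a: "\<And>j. norm (a j) \<le> 1" and "0 \<le> r"
  defines "good \<equiv> {z. \<exists>y. (\<Sum>j\<in>UNIV. exp (3 / 8 * (a j \<bullet> y)\<^sup>2)) \<le> 4 * real CARD('p) \<and> dist y z < r}"
  shows "good \<in> sets borel" "measure M (Z -` good \<inter> space M) \<ge> 1 - 2 * exp (- r\<^sup>2 / 4)"
proof -
  interpret prob_space M by fact
  have ZM [measurable]: "Z \<in> borel_measurable M" using Z by (rule gaussian_noise_measurable)
  let ?W = "\<lambda>y. \<Sum>j\<in>UNIV. exp (3 / 8 * (a j \<bullet> y)\<^sup>2)"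
  let ?p = "real CARD('p)"
  define A where "A = {y. ?W y \<le> 4 * ?p}"
  have "closed A" unfolding A_def by (intro closed_Collect_le continuous_intros)
  then have A [measurable]: "A \<in> sets borel" by simp
  have good_eq: "good = (\<Union>y\<in>A. ball y r)" unfolding good_def A_def by auto
  then show good [measurable]: "good \<in> sets borel" by (simp add: borel_open open_UN)
  have "(\<integral>\<^sup>+\<omega>. ennreal (?W (Z \<omega>)) \<partial>M) = (\<Sum>j\<in>UNIV. \<integral>\<^sup>+\<omega>. ennreal (exp (3 / 8 * (a j \<bullet> Z \<omega>)\<^sup>2)) \<partial>M)"
    by (subst nn_integral_sum[symmetric]) (auto simp: sum_ennreal)
  also have "\<dots> \<le> (\<Sum>j\<in>(UNIV :: 'p set). 2)"
    using a by (intro sum_mono gaussian_linear_exp_square[OF \<open>prob_space M\<close> Z])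
  finally have mean: "(\<integral>\<^sup>+\<omega>. ennreal (?W (Z \<omega>)) \<partial>M) \<le> ennreal (2 * ?p)"
    by (simp add: ennreal_mult' mult.commute ennreal_of_nat_eq_real_of_nat)
  have "emeasure M (space M - Z -` A)
      \<le> emeasure M {\<omega> \<in> space M. 1 \<le> ennreal (1 / (4 * ?p)) * ennreal (?W (Z \<omega>))}"
    by (intro emeasure_mono) (auto simp: A_def ennreal_mult'[symmetric] field_simps)
  also have "\<dots> \<le> ennreal (1 / (4 * ?p)) * (\<integral>\<^sup>+\<omega>. ennreal (?W (Z \<omega>)) * indicator (space M) \<omega> \<partial>M)"
    by (rule nn_integral_Markov_inequality) auto
  also have "(\<integral>\<^sup>+\<omega>. ennreal (?W (Z \<omega>)) * indicator (space M) \<omega> \<partial>M) = (\<integral>\<^sup>+\<omega>. ennreal (?W (Z \<omega>)) \<partial>M)"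
    by (intro nn_integral_cong) auto
  also have "ennreal (1 / (4 * ?p)) * (\<integral>\<^sup>+\<omega>. ennreal (?W (Z \<omega>)) \<partial>M) \<le> ennreal (1 / (4 * ?p)) * ennreal (2 * ?p)"
    by (rule mult_left_mono[OF mean]) simp
  also have "\<dots> = ennreal (1 / 2)" by (simp add: ennreal_mult'[symmetric])
  finally have "ennreal (prob (space M - Z -` A)) \<le> ennreal (1 / 2)" unfolding emeasure_eq_measure .
  then have "prob (space M - Z -` A) \<le> 1 / 2" by (subst (asm) ennreal_le_iff) auto
  moreover have "prob (space M - Z -` A) = 1 - prob (Z -` A \<inter> space M)"
    by (subst prob_compl[symmetric]) (auto intro!: arg_cong[where f=prob])
  ultimately have half: "1 / 2 \<le> prob (Z -` A \<inter> space M)" by simp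
  have "prob (Z -` A \<inter> space M) * prob (Z -` (- good) \<inter> space M) \<le> exp (- r\<^sup>2 / 4)"
  proof (rule gaussian_separated_sets[OF assms(1) Z A])
    show "- good \<in> sets borel" using good by (rule borel_comp)
    show "r \<le> dist x y" if "x \<in> A" "y \<in> - good" for x y
      using that unfolding good_eq by (auto simp: not_less)
  qed fact
  moreover have "1 / 2 * prob (Z -` (- good) \<inter> space M) \<le> prob (Z -` A \<inter> space M) * prob (Z -` (- good) \<inter> space M)"
    using half by (intro mult_right_mono) auto
  moreover have "prob (Z -` (- good) \<inter> space M) = 1 - prob (Z -` good \<inter> space M)"
    by (subst prob_compl[symmetric]) (auto intro!: arg_cong[where f=prob])
  ultimately show "prob (Z -` good \<inter> space M) \<ge> 1 - 2 * exp (- r\<^sup>2 / 4)" by simp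
qed

text \<open>A noise vector \<open>z\<close> close to a point \<open>y\<close> of small moment splits into \<open>y\<close>, whose contribution is controlled
by the sparsity norms of \<open>u\<close>, and \<open>z - y\<close>, which the Cauchy-Schwarz inequality pairs with the prediction
norm of \<open>u\<close>. The inequality holds for all \<open>u\<close> and all small \<open>S\<close> simultaneously, so one event serves every
\<open>f\<close> and every estimator.\<close>

lemma noise_bound:
  fixes X :: "real ^ 'p ^ 'n" and y z :: "real ^ 'n" and u :: "real ^ 'p"
  assumes s: "1 \<le> s" "card S \<le> s" and L: "1 \<le> L"
    and expL: "exp L = 2 * exp 1 * real CARD('p) / real s"
    and moment: "(\<Sum>j\<in>UNIV. exp (3 / 8 * ((column j X /\<^sub>R sqrt (real CARD('n))) \<bullet> y)\<^sup>2)) \<le> 4 * real CARD('p)"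
    and "dist y z \<le> r"
  shows "(z \<bullet> (X *v u)) / real CARD('n)
    \<le> (12 / 5 * sqrt L * (sqrt (real s) * norm u + (\<Sum>j\<in>-S. \<bar>u $ j\<bar>)) + r * emp_norm (X *v u)) / sqrt (real CARD('n))"
proof -
  define n where "n = sqrt (real CARD('n))"
  have n: "n > 0" "real CARD('n) = n * n" unfolding n_def by simp_all
  define w :: "real ^ 'p" where "w = (\<chi> j. (column j X /\<^sub>R n) \<bullet> y)"
  have "y \<bullet> (X *v u) = (\<Sum>j\<in>UNIV. u $ j * (y \<bullet> column j X))"
    unfolding matrix_mult_sum by (simp add: inner_sum_right scalar_mult_eq_scaleR)
  also have "\<dots> = (\<Sum>j\<in>UNIV. n * (w $ j * u $ j))"
    unfolding w_def using n by (intro sum.cong) (simp_all add: inner_commute[of y] field_simps)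
  also have "\<dots> = n * (w \<bullet> u)" unfolding inner_vec_def by (simp add: sum_distrib_left)
  finally have y: "y \<bullet> (X *v u) = n * (w \<bullet> u)" .
  have w: "w \<bullet> u \<le> 12 / 5 * sqrt L * (sqrt (real s) * norm u + (\<Sum>j\<in>-S. \<bar>u $ j\<bar>))"
    using moment by (intro exp_moment_inner_bound s L expL) (simp add: w_def n_def)
  have "(z - y) \<bullet> (X *v u) \<le> norm (z - y) * norm (X *v u)" by (rule norm_cauchy_schwarz)
  also have "\<dots> \<le> r * norm (X *v u)"
    using assms(6) by (intro mult_right_mono) (auto simp: dist_norm norm_minus_commute)
  also have "norm (X *v u) = n * emp_norm (X *v u)" using n unfolding emp_norm_eq n_def[symmetric] by simp
  finally have "z \<bullet> (X *v u) \<le> n * (w \<bullet> u + r * emp_norm (X *v u))"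
    using y by (simp add: inner_diff_left algebra_simps)
  also have "\<dots> \<le> n * (12 / 5 * sqrt L * (sqrt (real s) * norm u + (\<Sum>j\<in>-S. \<bar>u $ j\<bar>)) + r * emp_norm (X *v u))"
    using w n by (intro mult_left_mono add_right_mono) auto
  finally show ?thesis using n unfolding n(2) n_def[symmetric] by (simp add: field_simps)
qed

lemma oracle_inequality_deterministic:
  fixes X :: "real ^ 'p ^ 'n" and f xi :: "real ^ 'n" and b bhat :: "real ^ 'p" and s :: nat
  defines "u \<equiv> bhat - b" and "S \<equiv> {j. b $ j \<noteq> 0}" and "\<theta> \<equiv> theta X s 7"
  assumes "is_lasso X lam (f + xi) bhat" "l0_norm b \<le> s" "\<theta> > 0" "0 \<le> lam" "54 / 5 * \<kappa> \<le> lam"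
    and noise: "(xi \<bullet> (X *v u)) / real CARD('n)
      \<le> \<kappa> * (12 / 5 * (sqrt (real s) * norm u + (\<Sum>j\<in>-S. \<bar>u $ j\<bar>)) + 3 * (sqrt (real s) / \<theta> * emp_norm (X *v u)))"
  shows "lam / 2 * lq_norm 1 u + (emp_norm (X *v bhat - f))\<^sup>2
    \<le> (emp_norm (X *v b - f))\<^sup>2 + 49 * lam\<^sup>2 * real s / (16 * \<theta>\<^sup>2)"
proof -
  let ?R = "\<Sum>j\<in>-S. \<bar>u $ j\<bar>" and ?U = "\<Sum>j\<in>S. \<bar>u $ j\<bar>" and ?m = "sqrt (real s) * norm u"
  have split: "lq_norm 1 u = ?U + ?R" by (rule l1_norm_split)
  have "lam / 2 * (?U + ?R) + (emp_norm (X *v bhat - f))\<^sup>2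
    \<le> (emp_norm (X *v b - f))\<^sup>2 + 49 * lam\<^sup>2 * (sqrt (real s) / \<theta>)\<^sup>2 / 16"
  proof (rule oracle_inequality_scalar)
    show "?U \<le> ?m"
      using assms(5) by (intro sum_abs_le_sqrt_card) (simp add: S_def l0_norm_def)
    have "2 * lam * (lq_norm 1 b - lq_norm 1 bhat) \<le> 2 * lam * (?U - ?R)"
      using l1_norm_diff_le_support[of b bhat] \<open>0 \<le> lam\<close> unfolding u_def S_def by (intro mult_left_mono) auto
    then show "(emp_norm (X *v bhat - f))\<^sup>2 + (emp_norm (X *v u))\<^sup>2
        \<le> (emp_norm (X *v b - f))\<^sup>2 + 2 * ((xi \<bullet> (X *v u)) / real CARD('n)) + 2 * lam * (?U - ?R)"
      using lasso_basic_inequality[OF assms(4) \<open>0 \<le> lam\<close>, of b] unfolding u_def by linarith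
    assume "?U + ?R \<le> 8 * ?m"
    then have "u \<in> cone_SRE s 7" unfolding cone_SRE_def split[symmetric] lq_norm_2 by (simp add: mult.assoc)
    then have "norm u \<le> emp_norm (X *v u) / \<theta>"
      using theta_cone_le \<open>\<theta> > 0\<close> unfolding \<theta>_def by (simp add: pos_le_divide_eq mult.commute)
    then have "?m \<le> sqrt (real s) * (emp_norm (X *v u) / \<theta>)" by (intro mult_left_mono) auto
    then show "?m \<le> sqrt (real s) / \<theta> * emp_norm (X *v u)" by simp
  qed (use assms noise in \<open>auto simp: sum_nonneg emp_norm_eq\<close>)
  then show ?thesis unfolding split by (simp add: power_divide)
qed

text \<open>For an exact linear model the prediction bound already contains both endpoint estimates. The case
\<open>q = 1\<close> is immediate. For \<open>q = 2\<close>, inside the cone the Euclidean norm is controlled by the prediction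
norm, and outside the cone by the \<open>\<ell>\<^sub>1\<close> norm.\<close>

lemma estimation_from_prediction_bound:
  fixes X :: "real ^ 'p ^ 'n" and u :: "real ^ 'p" and s :: nat
  defines "\<theta> \<equiv> theta X s 7"
  assumes \<theta>: "\<theta> > 0" and s: "1 \<le> s" and lam: "lam > 0" and q: "1 \<le> q" "q \<le> 2"
    and risk: "lam / 2 * lq_norm 1 u + (emp_norm (X *v u))\<^sup>2 \<le> 49 * lam\<^sup>2 * real s / (16 * \<theta>\<^sup>2)"
  shows "lq_norm q u \<le> 49 * lam * real s powr (1 / q) / (8 * \<theta>\<^sup>2)"
proof -
  define c where "c = 49 * lam / (8 * \<theta>\<^sup>2)"
  have c: "c > 0" unfolding c_def using lam \<theta> by simp
  let ?x = "emp_norm (X *v u)"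
  have rhs: "49 * lam\<^sup>2 * real s / (16 * \<theta>\<^sup>2) = lam / 2 * (c * real s)"
    unfolding c_def by (simp add: power2_eq_square)
  have "lam / 2 * lq_norm 1 u \<le> lam / 2 * (c * real s)" using risk zero_le_power2[of ?x] unfolding rhs by linarith
  then have l1: "lq_norm 1 u \<le> c * real s" using lam by simp
  have "0 \<le> lam / 2 * lq_norm 1 u" using lam by (simp add: lq_norm_1 sum_nonneg)
  then have "?x\<^sup>2 \<le> 49 * lam\<^sup>2 * real s / (16 * \<theta>\<^sup>2)" using risk by linarith
  also have "\<dots> = (7 * lam * sqrt (real s) / (4 * \<theta>))\<^sup>2" by (simp add: power_divide power_mult_distrib)
  finally have x: "?x \<le> 7 * lam * sqrt (real s) / (4 * \<theta>)"
    by (rule power2_le_imp_le) (use lam \<theta> in auto)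
  have l2: "norm u \<le> c * sqrt (real s)"
  proof (cases "u \<in> cone_SRE s 7")
    case True
    have "norm u \<le> ?x / \<theta>"
      using theta_cone_le[OF True, of X] \<theta> unfolding \<theta>_def[symmetric] by (simp add: pos_le_divide_eq mult.commute)
    also have "\<dots> \<le> (7 * lam * sqrt (real s) / (4 * \<theta>)) / \<theta>" using x \<theta> by (intro divide_right_mono) auto
    also have "\<dots> = 2 / 7 * (c * sqrt (real s))" unfolding c_def by (simp add: power2_eq_square)
    also have "\<dots> \<le> c * sqrt (real s)" using c by simp
    finally show ?thesis .
  next
    case False
    then have "8 * sqrt (real s) * norm u < c * real s"
      using l1 unfolding cone_SRE_def lq_norm_2 by simp
    also have "c * real s = (c * sqrt (real s)) * sqrt (real s)" by simp
    finally have "sqrt (real s) * (8 * norm u) < sqrt (real s) * (c * sqrt (real s))" by (simp only: mult_ac)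
    then have "8 * norm u < c * sqrt (real s)" using s by (simp add: mult_less_cancel_left_pos)
    then show ?thesis using norm_ge_zero[of u] by linarith
  qed
  have "lq_norm q u \<le> c * real s powr (1 / q)"
    using q c l1 l2 by (intro lq_norm_interpolate) auto
  then show ?thesis unfolding c_def by simp
qed

section \<open>Prediction and estimation bounds for the Lasso\<close>

theorem corollary4p3:
  fixes M :: "'a measure" and X :: "real ^ 'p ^ 'n" and xi :: "'a \<Rightarrow> real ^ 'n"
    and \<sigma> lam :: real and s :: nat
  assumes "prob_space M"
    and "\<sigma> > 0"
    and "gaussian_noise M \<sigma> xi"
    and "1 \<le> s" and "s \<le> CARD('p)"
    and "SRE X s 7"
    and "lam \<ge> 2 * (4 + sqrt 2) * \<sigma> *
           sqrt (ln (2 * exp 1 * real CARD('p) / real s) / real CARD('n))"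
  shows "measure M {\<omega> \<in> space M. \<forall>(f :: real ^ 'n) (b :: real ^ 'p) (bhat :: real ^ 'p).
            is_lasso X lam (f + xi \<omega>) bhat \<longrightarrow> l0_norm b \<le> s \<longrightarrow>
            lam / 2 * lq_norm 1 (bhat - b) + (emp_norm (X *v bhat - f))\<^sup>2
              \<le> (emp_norm (X *v b - f))\<^sup>2 + 49 * lam\<^sup>2 * real s / (16 * (theta X s 7)\<^sup>2)}
          \<ge> 1 - 1 / 2 * (real s / (2 * exp 1 * real CARD('p))) powr (real s / (theta X s 7)\<^sup>2)
       \<and> (\<forall>(bstar :: real ^ 'p) (q :: real). l0_norm bstar \<le> s \<longrightarrow> 1 \<le> q \<longrightarrow> q \<le> 2 \<longrightarrow>
            measure M {\<omega> \<in> space M. \<forall>bhat :: real ^ 'p.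
              is_lasso X lam (X *v bstar + xi \<omega>) bhat \<longrightarrow>
              lq_norm q (bhat - bstar)
                \<le> 49 * lam * real s powr (1 / q) / (8 * (theta X s 7)\<^sup>2)}
            \<ge> 1 - 1 / 2 * (real s / (2 * exp 1 * real CARD('p))) powr (real s / (theta X s 7)\<^sup>2))"
proof -
  interpret prob_space M by fact
  let ?n = "real CARD('n)" and ?p = "real CARD('p)"
  define \<theta> where "\<theta> = theta X s 7"
  define L where "L = ln (2 * exp 1 * ?p / real s)"
  (* exp (- t^2) is the power of s / (2 e p) in the probability bound *)
  define t where "t = sqrt L * (sqrt (real s) / \<theta>)"
  define \<kappa> where "\<kappa> = \<sigma> * sqrt (L / ?n)"
  define a :: "'p \<Rightarrow> real ^ 'n" where "a = (\<lambda>j. column j X /\<^sub>R sqrt ?n)"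
  have s: "1 \<le> s" "0 < real s" "real s \<le> ?p" using assms by auto
  have \<theta>: "0 < \<theta>" "\<theta> \<le> 1"
    using assms theta_le_1[of X s 7] unfolding SRE_def \<theta>_def by auto
  have expL: "exp L = 2 * exp 1 * ?p / real s" unfolding L_def using s by simp
  have "2 * exp 1 * 1 \<le> 2 * exp 1 * (?p / real s)" using s by (intro mult_left_mono) auto
  then have eL: "2 * exp 1 \<le> exp L" unfolding expL by simp
  have e2: "2 \<le> exp (1::real)" using exp_ge_add_one_self[of "1::real"] by simp
  have "exp 1 \<le> exp L" using eL by (rule order_trans[rotated]) simp
  then have L: "1 \<le> L" by simp
  have "1 \<le> real s / \<theta>\<^sup>2"
  proof -
    have "\<theta>\<^sup>2 \<le> 1" using \<theta> by (simp add: power_le_one)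
    then have "\<theta>\<^sup>2 \<le> real s" using s by linarith
    then show ?thesis using \<theta> by simp
  qed
  then have "L * 1 \<le> L * (real s / \<theta>\<^sup>2)" using L by (intro mult_left_mono) auto
  moreover have t2: "t\<^sup>2 = L * (real s / \<theta>\<^sup>2)"
    unfolding t_def using L by (simp add: power_mult_distrib power_divide)
  ultimately have t: "L \<le> t\<^sup>2" "0 \<le> t" using L \<theta> by (auto simp: t_def)
  have \<delta>: "(real s / (2 * exp 1 * ?p)) powr (real s / \<theta>\<^sup>2) = exp (- t\<^sup>2)"
  proof -
    have "real s / (2 * exp 1 * ?p) = exp (- L)" unfolding exp_minus expL by simp
    then show ?thesis by (simp add: t2 powr_def mult.commute)
  qed
  (* as t^2 \<ge> L, the surplus in the exponent gives a factor exp (- L) \<le> 1 / 4 *)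
  have tail: "2 * exp (- (3 * t)\<^sup>2 / 4) \<le> 1 / 2 * exp (- t\<^sup>2)"
  proof -
    have "exp (- (3 * t)\<^sup>2 / 4) \<le> exp (- L + - t\<^sup>2)" using t L by (simp add: power_mult_distrib)
    also have "\<dots> = 1 / exp L * exp (- t\<^sup>2)" unfolding exp_add by (simp add: exp_minus divide_inverse)
    also have "\<dots> \<le> 1 / 4 * exp (- t\<^sup>2)"
      using eL e2 by (intro mult_right_mono divide_left_mono) auto
    finally show ?thesis by simp
  qed
  (* 27 / 5 = 12 / 5 + 3 is the sum of the two constants in the noise bound *)
  have "27 / 5 \<le> 4 + sqrt 2"
    using real_le_rsqrt[of "7 / 5" 2] by (simp add: power2_eq_square)
  then have "2 * (27 / 5) * \<kappa> \<le> 2 * (4 + sqrt 2) * \<kappa>"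
    using assms(2) L by (intro mult_right_mono) (auto simp: \<kappa>_def)
  then have \<kappa>: "54 / 5 * \<kappa> \<le> lam" using assms(7) unfolding \<kappa>_def L_def by (simp add: mult.assoc)
  have "0 < \<kappa>" unfolding \<kappa>_def using assms(2) L by simp
  then have lam: "0 < lam" using \<kappa> by linarith
  define Z where "Z = (\<lambda>\<omega>. xi \<omega> /\<^sub>R \<sigma>)"
  have Z: "gaussian_noise M 1 Z"
    unfolding Z_def by (rule gaussian_noise_standardize[OF assms(1-3)])
  have xiM [measurable]: "xi \<in> borel_measurable M" using assms(3) by (rule gaussian_noise_measurable)
  have a: "norm (a j) \<le> 1" for j
  proof -
    have "norm (a j) = emp_norm (X *v axis j 1)"
      unfolding a_def emp_norm_eq by (simp add: matrix_vector_mult_basis divide_inverse mult.commute)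
    then show ?thesis using assms(6) unfolding SRE_def by simp
  qed
  define good where "good = {z. \<exists>y. (\<Sum>j\<in>UNIV. exp (3 / 8 * (a j \<bullet> y)\<^sup>2)) \<le> 4 * ?p \<and> dist y z < 3 * t}"
  have good: "good \<in> sets borel" "1 - 2 * exp (- (3 * t)\<^sup>2 / 4) \<le> prob (Z -` good \<inter> space M)"
    unfolding good_def using gaussian_moment_neighbourhood[OF assms(1) Z a, of "3 * t"] t by auto
  have prob_good: "1 - 1 / 2 * exp (- t\<^sup>2) \<le> prob (Z -` good \<inter> space M)"
    using good(2) tail by linarith
  have risk: "lam / 2 * lq_norm 1 (bhat - b) + (emp_norm (X *v bhat - f))\<^sup>2
      \<le> (emp_norm (X *v b - f))\<^sup>2 + 49 * lam\<^sup>2 * real s / (16 * \<theta>\<^sup>2)"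
    if Z_good: "Z \<omega> \<in> good" and "is_lasso X lam (f + xi \<omega>) bhat" and sparse: "l0_norm b \<le> s" for \<omega> f b bhat
  proof -
    obtain y where y: "(\<Sum>j\<in>UNIV. exp (3 / 8 * (a j \<bullet> y)\<^sup>2)) \<le> 4 * ?p" "dist y (Z \<omega>) < 3 * t"
      using Z_good unfolding good_def by blast
    let ?S = "{j. b $ j \<noteq> 0}" and ?u = "bhat - b"
    have "(Z \<omega> \<bullet> (X *v ?u)) / ?n
        \<le> (12 / 5 * sqrt L * (sqrt (real s) * norm ?u + (\<Sum>j\<in>-?S. \<bar>?u $ j\<bar>)) + 3 * t * emp_norm (X *v ?u)) / sqrt ?n"
      using y s(1) sparse unfolding a_def
      by (intro noise_bound L expL) (auto simp: l0_norm_def)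
    then have "\<sigma> * ((Z \<omega> \<bullet> (X *v ?u)) / ?n)
        \<le> \<sigma> * ((12 / 5 * sqrt L * (sqrt (real s) * norm ?u + (\<Sum>j\<in>-?S. \<bar>?u $ j\<bar>)) + 3 * t * emp_norm (X *v ?u)) / sqrt ?n)"
      using assms(2) by (intro mult_left_mono) auto
    also have "\<sigma> * ((Z \<omega> \<bullet> (X *v ?u)) / ?n) = (xi \<omega> \<bullet> (X *v ?u)) / ?n"
      using assms(2) unfolding Z_def by simp
    also have "\<sigma> * ((12 / 5 * sqrt L * (sqrt (real s) * norm ?u + (\<Sum>j\<in>-?S. \<bar>?u $ j\<bar>)) + 3 * t * emp_norm (X *v ?u)) / sqrt ?n)
       = \<kappa> * (12 / 5 * (sqrt (real s) * norm ?u + (\<Sum>j\<in>-?S. \<bar>?u $ j\<bar>)) + 3 * (sqrt (real s) / \<theta> * emp_norm (X *v ?u)))"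
      unfolding \<kappa>_def t_def real_sqrt_divide by (simp add: field_simps)
    finally show ?thesis
      using that lam \<theta> \<kappa> unfolding \<theta>_def by (intro oracle_inequality_deterministic) auto
  qed
  have event: "1 - 1 / 2 * (real s / (2 * exp 1 * ?p)) powr (real s / \<theta>\<^sup>2) \<le> prob {\<omega> \<in> space M. xi \<omega> \<in> E}"
    if "E \<in> sets borel" "\<And>\<omega>. Z \<omega> \<in> good \<Longrightarrow> xi \<omega> \<in> E" for E
  proof -
    have "prob (Z -` good \<inter> space M) \<le> prob {\<omega> \<in> space M. xi \<omega> \<in> E}"
      using that by (intro finite_measure_mono) auto
    then show ?thesis using prob_good unfolding \<delta> by linarith
  qed
  have est: "lq_norm q (bhat - bstar) \<le> 49 * lam * real s powr (1 / q) / (8 * \<theta>\<^sup>2)"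
    if "1 \<le> q" "q \<le> 2" "l0_norm bstar \<le> s" "Z \<omega> \<in> good" "is_lasso X lam (X *v bstar + xi \<omega>) bhat" for q bstar bhat \<omega>
  proof -
    have "emp_norm (0 :: real ^ 'n) = 0" by (simp add: emp_norm_eq)
    then have "lam / 2 * lq_norm 1 (bhat - bstar) + (emp_norm (X *v (bhat - bstar)))\<^sup>2 \<le> 49 * lam\<^sup>2 * real s / (16 * \<theta>\<^sup>2)"
      using risk[OF that(4,5,3)] by (simp add: matrix_vector_mult_diff_distrib)
    then show ?thesis using \<theta> s lam that unfolding \<theta>_def by (intro estimation_from_prediction_bound) auto
  qed
  show ?thesis
    unfolding \<theta>_def[symmetric]
  proof (intro conjI allI impI)
    show "1 - 1 / 2 * (real s / (2 * exp 1 * ?p)) powr (real s / \<theta>\<^sup>2)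
      \<le> prob {\<omega> \<in> space M. \<forall>(f :: real ^ 'n) (b :: real ^ 'p) (bhat :: real ^ 'p).
            is_lasso X lam (f + xi \<omega>) bhat \<longrightarrow> l0_norm b \<le> s \<longrightarrow>
            lam / 2 * lq_norm 1 (bhat - b) + (emp_norm (X *v bhat - f))\<^sup>2
              \<le> (emp_norm (X *v b - f))\<^sup>2 + 49 * lam\<^sup>2 * real s / (16 * \<theta>\<^sup>2)}"
      using event[OF prediction_event_borel[of X lam s "49 * lam\<^sup>2 * real s / (16 * \<theta>\<^sup>2)"]] risk
      unfolding mem_Collect_eq by blast
    fix bstar :: "real ^ 'p" and q :: real
    assume "l0_norm bstar \<le> s" "1 \<le> q" "q \<le> 2"
    then show "1 - 1 / 2 * (real s / (2 * exp 1 * ?p)) powr (real s / \<theta>\<^sup>2)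
      \<le> prob {\<omega> \<in> space M. \<forall>bhat :: real ^ 'p. is_lasso X lam (X *v bstar + xi \<omega>) bhat \<longrightarrow>
              lq_norm q (bhat - bstar) \<le> 49 * lam * real s powr (1 / q) / (8 * \<theta>\<^sup>2)}"
      using event[OF estimation_event_borel[of q X lam bstar "49 * lam * real s powr (1 / q) / (8 * \<theta>\<^sup>2)"]] est
      unfolding mem_Collect_eq by blast
  qed
qed

end
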